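(* Let $\mathbb F$ be $\mathbb C$ or $\mathbb R$, let $Q$ be a quiver, and let $A=A_1\oplus\dots\oplus A_s$ ($s\ge 2$) be a matrix representation of $Q$ over $\mathbb F$, where $A_1,\dots,A_s$ are matrix representations of $Q$. Let $$\mathcal A(\vec\varepsilon)=A+B(\vec\varepsilon)=\begin{bmatrix} A_1+B_{11}(\vec\varepsilon)&B_{12}(\vec\varepsilon)&\dots&B_{1s}(\vec\varepsilon)\\ B_{21}(\vec\varepsilon)&A_2+B_{22}(\vec\varepsilon)&\dots&B_{2s}(\vec\varepsilon)\\ \vdots&\vdots&\ddots&\vdots\\ B_{s1}(\vec\varepsilon)&B_{s2}(\vec\varepsilon)&\dots&A_s+B_{ss}(\vec\varepsilon)\end{bmatrix}$$ be a deformation of $A$ of the form $A+\sum_{(\alpha,i,j)\in\varGamma}\varepsilon_{\alpha ij}E_{\alpha ij}$ for some $\varGamma\subset\Upsilon_{\vec n}$ (where $\vec n$ is the dimension of $A$), whose matrices are partitioned into blocks conformably to the partition of $A$. Then $\mathcal A(\vec\varepsilon)$ is a simplest miniversal deformation of $A$ if and only if, for all $1\le p<q\le s$, $$\mathcal A_{pq}(\vec\varepsilon):=\begin{bmatrix}A_p+B_{pp}(\vec\varepsilon)&B_{pq}(\vec\varepsilon)\\ B_{qp}(\vec\varepsilon)&A_q+B_{qq}(\vec\varepsilon)\end{bmatrix}$$ (regarded as a deformation whose parameters are those $\varepsilon_{\alpha ij}$ that occur in it) is a simplest miniversal deformation of $A_p\oplus A_q$.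
   Context: Let $\mathbb F\in\{\mathbb R,\mathbb C\}$ and let $Q$ be a quiver with vertices $1,\dots,t$ and finitely many arrows (loops and multiple arrows are allowed). A matrix representation $A$ of $Q$ of dimension $\vec n=(n_1,\dots,n_t)\in\{0,1,2,\dots\}^t$ assigns to each arrow $\alpha\colon p\to q$ a matrix $A_\alpha\in\mathbb F^{n_q\times n_p}$. The direct sum is defined by $(A\oplus B)_\alpha=A_\alpha\oplus B_\alpha$ (block diagonal). The block-matrix displays in the claim are to be read arrow by arrow: for each arrow $\alpha$ the matrix assigned to $\alpha$ is the block matrix formed by the matrices that the blocks assign to $\alpha$. A deformation of $A$ is a matrix representation $\mathcal A(\lambda_1,\dots,\lambda_k)$ whose matrix entries are power series over $\mathbb F$ in the parameters $\lambda_1,\dots,\lambda_k$ convergent in a neighborhood of $\vec 0$, with $\mathcal A(\vec 0)=A$. Two deformations $\mathcal A(\vec\lambda),\mathcal B(\vec\lambda)$ of $A$ are equivalent if there are matrices $\mathcal I_1(\vec\lambda),\dots,\mathcal I_t(\vec\lambda)$ of sizes $n_1\times n_1,\dots,n_t\times n_t$, whose entries are power series convergent in a neighborhood of $\vec 0$, with $\mathcal I_p(\vec 0)=I_{n_p}$, such that $\mathcal B_\alpha(\vec\lambda)=\mathcal I_q(\vec\lambda)\mathcal A_\alpha(\vec\lambda)\mathcal I_p(\vec\lambda)^{-1}$ for each arrow $\alpha\colon p\to q$ in a neighborhood of $\vec 0$. A deformation $\mathcal A(\lambda_1,\dots,\lambda_k)$ of $A$ is versal if every deformation $\mathcal B(\mu_1,\dots,\mu_l)$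 of $A$ is equivalent to a deformation of the form $\mathcal A(\varphi_1(\vec\mu),\dots,\varphi_k(\vec\mu))$, where the $\varphi_i$ are power series convergent in a neighborhood of $\vec 0$ with $\varphi_i(\vec 0)=0$. A versal deformation with $k$ parameters is miniversal if there is no versal deformation of $A$ with fewer than $k$ parameters. $\Upsilon_{\vec n}$ is the set of all triples $(\alpha,i,j)$ with $\alpha\colon p\to q$ an arrow of $Q$, $1\le i\le n_q$, $1\le j\le n_p$. The elementary representation $E_{\alpha ij}$ is the representation of dimension $\vec n$ all of whose matrix entries are $0$ except for the $(i,j)$ entry of the matrix assigned to $\alpha$, which is $1$. A simplest miniversal deformation of $A$ is a miniversal deformation of the form $A+\sum_{(\alpha,i,j)\in\varGamma}\varepsilon_{\alpha ij}E_{\alpha ij}$ with $\varGamma\subset\Upsilon_{\vec n}$ and independent parameters $\varepsilon_{\alpha ij}$. *)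

theory Defs
  imports
    "HOL-Analysis.Euclidean_Space"
    "HOL-Analysis.Infinite_Sum"
    "Jordan_Normal_Form.Matrix"
    "Graph_Theory.Digraph"
begin

text \<open>
  The ground field: every type of this class is isometrically isomorphic to \<open>\<real>\<close> or \<open>\<complex>\<close>, the norm of a
  \<^class>\<open>real_normed_field\<close> being multiplicative (Frobenius).
\<close>

class real_or_complex = real_normed_field + euclidean_space

instance real :: real_or_complex ..
instance complex :: real_or_complex ..

text \<open>
  A quiver is a finite directed multigraph (\<^locale>\<open>fin_digraph\<close>, which admits loops and parallel
  arcs); an arrow \<open>a\<close> goes from \<open>tail Q a\<close> to \<open>head Q a\<close>. Vertices may have dimension \<open>0\<close>: the type
  of matrices distinguishes all sizes \<open>m \<times> 0\<close> and \<open>0 \<times> m\<close>. Matrix rows and columns are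
  counted from \<open>0\<close>, as are the direct summands. Values of a representation outside \<open>arcs Q\<close> and of
  a dimension outside \<open>verts Q\<close> are irrelevant.
\<close>

type_synonym ('e, 'a) rep = "'e \<Rightarrow> 'a mat"

definition is_rep :: "('v, 'e) pre_digraph \<Rightarrow> ('v \<Rightarrow> nat) \<Rightarrow> ('e, 'a) rep \<Rightarrow> bool" where
  "is_rep Q n A \<longleftrightarrow> (\<forall>a\<in>arcs Q. A a \<in> carrier_mat (n (head Q a)) (n (tail Q a)))"

definition rep_sum :: "('e, 'a :: zero) rep list \<Rightarrow> ('e, 'a) rep" where
  "rep_sum As = (\<lambda>a. diag_block_mat (map (\<lambda>A. A a) As))"


text \<open>
  Functions of finitely many parameters, indexed by a finite set \<open>P\<close>, have argument type
  \<open>'p \<Rightarrow> 'a\<close>, the coordinates outside \<open>P\<close> being ignored. They are considered only near the origin,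
  so a convergent power series is represented by any function that agrees with its sum there.
\<close>

definition near_zero :: "'p set \<Rightarrow> (('p \<Rightarrow> 'a :: real_normed_field) \<Rightarrow> bool) \<Rightarrow> bool" where
  "near_zero P R \<longleftrightarrow> (\<exists>r>0. \<forall>x. (\<forall>i\<in>P. norm (x i) < r) \<longrightarrow> R x)"

text \<open>The function \<open>m\<close> ranges over the multi-indices supported in \<open>P\<close>.\<close>

definition conv_power_series :: "'p set \<Rightarrow> (('p \<Rightarrow> 'a :: real_normed_field) \<Rightarrow> 'a) \<Rightarrow> bool" where
  "conv_power_series P f \<longleftrightarrow>
     (\<exists>c. near_zero P (\<lambda>x.
        ((\<lambda>m. c m * (\<Prod>i\<in>P. x i ^ m i)) has_sum f x) {m :: 'p \<Rightarrow> nat. \<forall>i. i \<notin> P \<longrightarrow> m i = 0}))"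

definition conv_power_series_mat ::
  "'p set \<Rightarrow> nat \<Rightarrow> nat \<Rightarrow> (('p \<Rightarrow> 'a :: real_normed_field) \<Rightarrow> 'a mat) \<Rightarrow> bool" where
  "conv_power_series_mat P nr nc M \<longleftrightarrow>
     near_zero P (\<lambda>x. M x \<in> carrier_mat nr nc) \<and>
     (\<forall>i<nr. \<forall>j<nc. conv_power_series P (\<lambda>x. M x $$ (i, j)))"

definition is_deformation ::
  "('v, 'e) pre_digraph \<Rightarrow> ('v \<Rightarrow> nat) \<Rightarrow> ('e, 'a :: real_normed_field) rep \<Rightarrow>
   'p set \<Rightarrow> (('p \<Rightarrow> 'a) \<Rightarrow> ('e, 'a) rep) \<Rightarrow> bool" where
  "is_deformation Q n A P F \<longleftrightarrow>
     finite P \<and>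
     (\<forall>a\<in>arcs Q. conv_power_series_mat P (n (head Q a)) (n (tail Q a)) (\<lambda>x. F x a) \<and>
                 F (\<lambda>_. 0) a = A a)"

definition equivalent_deformations ::
  "('v, 'e) pre_digraph \<Rightarrow> ('v \<Rightarrow> nat) \<Rightarrow> 'p set \<Rightarrow>
   (('p \<Rightarrow> 'a :: real_normed_field) \<Rightarrow> ('e, 'a) rep) \<Rightarrow> (('p \<Rightarrow> 'a) \<Rightarrow> ('e, 'a) rep) \<Rightarrow> bool" where
  "equivalent_deformations Q n P F G \<longleftrightarrow>
     (\<exists>S :: 'v \<Rightarrow> ('p \<Rightarrow> 'a) \<Rightarrow> 'a mat.
        (\<forall>v\<in>verts Q. conv_power_series_mat P (n v) (n v) (S v) \<and> S v (\<lambda>_. 0) = 1\<^sub>m (n v)) \<and>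
        near_zero P (\<lambda>x. \<forall>a\<in>arcs Q.
          \<exists>T \<in> carrier_mat (n (tail Q a)) (n (tail Q a)).
            inverts_mat (S (tail Q a) x) T \<and> inverts_mat T (S (tail Q a) x) \<and>
            G x a = S (head Q a) x * F x a * T))"

definition versal ::
  "('v, 'e) pre_digraph \<Rightarrow> ('v \<Rightarrow> nat) \<Rightarrow> ('e, 'a :: real_normed_field) rep \<Rightarrow>
   'p set \<Rightarrow> (('p \<Rightarrow> 'a) \<Rightarrow> ('e, 'a) rep) \<Rightarrow> bool" where
  "versal Q n A P F \<longleftrightarrow>
     is_deformation Q n A P F \<and>
     (\<forall>(l :: nat) G. is_deformation Q n A {..<l} G \<longrightarrow>
        (\<exists>\<phi> :: 'p \<Rightarrow> (nat \<Rightarrow> 'a) \<Rightarrow> 'a.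
           (\<forall>i\<in>P. conv_power_series {..<l} (\<phi> i) \<and> \<phi> i (\<lambda>_. 0) = 0) \<and>
           equivalent_deformations Q n {..<l} G (\<lambda>\<mu>. F (\<lambda>i. \<phi> i \<mu>))))"

definition miniversal ::
  "('v, 'e) pre_digraph \<Rightarrow> ('v \<Rightarrow> nat) \<Rightarrow> ('e, 'a :: real_normed_field) rep \<Rightarrow>
   'p set \<Rightarrow> (('p \<Rightarrow> 'a) \<Rightarrow> ('e, 'a) rep) \<Rightarrow> bool" where
  "miniversal Q n A P F \<longleftrightarrow>
     versal Q n A P F \<and>
     \<not> (\<exists>k < card P. \<exists>F' :: (nat \<Rightarrow> 'a) \<Rightarrow> ('e, 'a) rep. versal Q n A {..<k} F')"

definition Upsilon :: "('v, 'e) pre_digraph \<Rightarrow> ('v \<Rightarrow> nat) \<Rightarrow> ('e \<times> nat \<times> nat) set" where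
  "Upsilon Q n = {(a, i, j). a \<in> arcs Q \<and> i < n (head Q a) \<and> j < n (tail Q a)}"

definition elem_rep ::
  "('v, 'e) pre_digraph \<Rightarrow> ('v \<Rightarrow> nat) \<Rightarrow> 'e \<Rightarrow> nat \<Rightarrow> nat \<Rightarrow> ('e, 'a :: zero_neq_one) rep" where
  "elem_rep Q n a i j = (\<lambda>b. mat (n (head Q b)) (n (tail Q b))
     (\<lambda>(i', j'). if b = a \<and> i' = i \<and> j' = j then 1 else 0))"

text \<open>
  The representation \<open>\<Sum>(a, i, j)\<in>\<Gamma>. \<epsilon> (a, i, j) E a i j\<close>, written entrywise since matrices of
  varying size are not an additive monoid as a type.
\<close>

definition elem_comb ::
  "('v, 'e) pre_digraph \<Rightarrow> ('v \<Rightarrow> nat) \<Rightarrow> ('e \<times> nat \<times> nat) set \<Rightarrow>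
   ('e \<times> nat \<times> nat \<Rightarrow> 'a :: real_normed_field) \<Rightarrow> ('e, 'a) rep" where
  "elem_comb Q n \<Gamma> \<epsilon> = (\<lambda>b. mat (n (head Q b)) (n (tail Q b))
     (\<lambda>ij. \<Sum>(a, i, j)\<in>\<Gamma>. \<epsilon> (a, i, j) * elem_rep Q n a i j b $$ ij))"

text \<open>
  The bijection \<open>\<pi>\<close> names the parameters: the parameter attached to \<open>g \<in> \<Gamma>\<close> is the coordinate
  \<open>\<pi> g \<in> P\<close>.
\<close>

definition simplest_miniversal ::
  "('v, 'e) pre_digraph \<Rightarrow> ('v \<Rightarrow> nat) \<Rightarrow> ('e, 'a :: real_normed_field) rep \<Rightarrow>
   'p set \<Rightarrow> (('p \<Rightarrow> 'a) \<Rightarrow> ('e, 'a) rep) \<Rightarrow> bool" where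
  "simplest_miniversal Q n A P F \<longleftrightarrow>
     miniversal Q n A P F \<and>
     (\<exists>\<Gamma> \<pi>. \<Gamma> \<subseteq> Upsilon Q n \<and> bij_betw \<pi> \<Gamma> P \<and>
        near_zero P (\<lambda>\<epsilon>. \<forall>a\<in>arcs Q. F \<epsilon> a = A a + elem_comb Q n \<Gamma> (\<lambda>g. \<epsilon> (\<pi> g)) a))"


text \<open>
  Block partition for summands of dimensions \<open>n 0, n 1, \<dots>\<close>: \<open>strip n p v\<close> is the set of row or column
  indices at the vertex \<open>v\<close> that belong to the summand \<open>p\<close>.
\<close>

definition offset :: "(nat \<Rightarrow> 'v \<Rightarrow> nat) \<Rightarrow> nat \<Rightarrow> 'v \<Rightarrow> nat" where
  "offset n p v = (\<Sum>k<p. n k v)"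

definition strip :: "(nat \<Rightarrow> 'v \<Rightarrow> nat) \<Rightarrow> nat \<Rightarrow> 'v \<Rightarrow> nat set" where
  "strip n p v = {offset n p v..<offset n p v + n p v}"

definition rep_block ::
  "('v, 'e) pre_digraph \<Rightarrow> (nat \<Rightarrow> 'v \<Rightarrow> nat) \<Rightarrow> nat \<Rightarrow> nat \<Rightarrow> ('e, 'a) rep \<Rightarrow> ('e, 'a) rep" where
  "rep_block Q n p q B = (\<lambda>a. mat (n p (head Q a)) (n q (tail Q a))
     (\<lambda>(i, j). B a $$ (offset n p (head Q a) + i, offset n q (tail Q a) + j)))"

definition pair_params ::
  "('v, 'e) pre_digraph \<Rightarrow> (nat \<Rightarrow> 'v \<Rightarrow> nat) \<Rightarrow> ('e \<times> nat \<times> nat) set \<Rightarrow> nat \<Rightarrow> nat \<Rightarrow>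
   ('e \<times> nat \<times> nat) set" where
  "pair_params Q n \<Gamma> p q =
     {(a, i, j) \<in> \<Gamma>. i \<in> strip n p (head Q a) \<union> strip n q (head Q a) \<and>
                     j \<in> strip n p (tail Q a) \<union> strip n q (tail Q a)}"

definition pair_family ::
  "('v, 'e) pre_digraph \<Rightarrow> (nat \<Rightarrow> 'v \<Rightarrow> nat) \<Rightarrow> (nat \<Rightarrow> ('e, 'a :: real_normed_field) rep) \<Rightarrow>
   (('p \<Rightarrow> 'a) \<Rightarrow> ('e, 'a) rep) \<Rightarrow> nat \<Rightarrow> nat \<Rightarrow> ('p \<Rightarrow> 'a) \<Rightarrow> ('e, 'a) rep" where
  "pair_family Q n A B p q = (\<lambda>\<epsilon> a. four_block_mat
     (A p a + rep_block Q n p p (B \<epsilon>) a) (rep_block Q n p q (B \<epsilon>) a)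
     (rep_block Q n q p (B \<epsilon>) a)         (A q a + rep_block Q n q q (B \<epsilon>) a))"

end

theory Submission
  imports
    Defs
    "HOL-Analysis.Topology_Euclidean_Space"
    "Jordan_Normal_Form.Determinant"
begin

text \<open>Call a coordinate set \<open>\<Gamma>\<close> a complement at a representation \<open>A\<close> if the representations
  supported on \<open>\<Gamma>\<close> form a linear complement of the tangent space
  \<open>{(X\<^sub>h A\<^sub>a - A\<^sub>a X\<^sub>t)\<^sub>a}\<close> (\<open>h\<close> the head and \<open>t\<close> the tail of \<open>a\<close>) of the orbit of \<open>A\<close> under change
  of basis. The theorem rests on two facts.

  \<^item> The family \<open>A + \<Sum>\<^sub>g\<^sub>\<in>\<^sub>\<Gamma> \<epsilon>\<^sub>g E\<^sub>g\<close> is miniversal exactly if \<open>\<Gamma>\<close> is a complement at \<open>A\<close>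
    (\<open>miniversal_iff_transversal\<close>).

  \<^item> If \<open>A\<close> is a direct sum, then the block \<open>(p, q)\<close> of \<open>X A - A X\<close> depends only on the block \<open>(p, q)\<close>
    of \<open>X\<close>: it is \<open>X\<^sub>p\<^sub>q A\<^sub>q - A\<^sub>p X\<^sub>p\<^sub>q\<close>. So \<open>\<Gamma>\<close> is a complement exactly if, for all
    \<open>p\<close> and \<open>q\<close>, its block \<open>(p, q)\<close> is one for the image of \<open>Y \<mapsto> Y A\<^sub>q - A\<^sub>p Y\<close>
    (\<open>transversal_rep_sum\<close>).

  By the second fact the condition for \<open>A\<^sub>1 \<oplus> \<dots> \<oplus> A\<^sub>s\<close> is a conjunction of conditions indexed
  by all pairs \<open>(p, q)\<close>, and the condition for \<open>A\<^sub>p \<oplus> A\<^sub>q\<close> is the part of it indexed by \<open>(p, p)\<close>,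
  \<open>(p, q)\<close>, \<open>(q, p)\<close> and \<open>(q, q)\<close>. Since \<open>s \<ge> 2\<close>, these parts cover everything.

  The first fact has an infinitesimal and an analytic half. Differentiating the
  equivalence of a one-parameter deformation \<open>A + \<mu> C\<close> with a pull-back of a versal family at
  \<open>\<mu> = 0\<close> shows that the derivatives of any versal family span all representations modulo the
  tangent space (\<open>versal_tangent\<close>), which bounds the number of parameters from below. Conversely,
  if the coordinates in \<open>\<Gamma>\<close> span modulo the tangent space, then the equivalence with a given
  deformation \<open>A - H\<close> has to solve \<open>(I + X)(A - H) = (A + \<Phi>)(I + X)\<close> for \<open>X\<close> and for \<open>\<Phi>\<close> supported on \<open>\<Gamma>\<close>
  (\<open>versal_of_spanning\<close>). After composing with a right inverse of the linear part, this is a system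
  of the form \<open>w = H + quadratic terms\<close>. Such a system determines the
  power series of \<open>w\<close> degree by degree, and a majorant argument gives convergence
  (\<open>quadratic_system_solution\<close>); this takes the place of an analytic implicit function theorem and
  works over \<open>\<real>\<close> and \<open>\<complex>\<close> alike.\<close>

section \<open>Convergent power series near the origin\<close>

lemma near_zero_mono:
  assumes "near_zero P R" "\<And>x. R x \<Longrightarrow> R' x"
  shows "near_zero P R'"
  using assms unfolding near_zero_def by blast

lemma near_zero_conj:
  assumes "near_zero P R" "near_zero P R'"
  shows "near_zero P (\<lambda>x. R x \<and> R' x)"
proof -
  obtain r r' where "r > 0" "\<forall>x. (\<forall>i\<in>P. norm (x i) < r) \<longrightarrow> R x"
    "r' > 0" "\<forall>x. (\<forall>i\<in>P. norm (x i) < r') \<longrightarrow> R' x"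
    using assms unfolding near_zero_def by blast
  then show ?thesis
    unfolding near_zero_def by (intro exI[of _ "min r r'"]) auto
qed

lemma near_zero_all: "(\<And>x. R x) \<Longrightarrow> near_zero P R"
  unfolding near_zero_def by (rule exI[of _ 1]) auto

lemma near_zero_ball:
  assumes "finite I" "\<And>i. i \<in> I \<Longrightarrow> near_zero P (R i)"
  shows "near_zero P (\<lambda>x. \<forall>i\<in>I. R i x)"
  using assms
proof (induction I)
  case empty
  show ?case by (rule near_zero_all) auto
next
  case (insert i I)
  have "near_zero P (\<lambda>x. R i x \<and> (\<forall>i\<in>I. R i x))"
    using insert by (intro near_zero_conj) auto
  then show ?case by (rule near_zero_mono) auto
qed

lemma near_zeroD0:
  assumes "near_zero P R"
  shows "R (\<lambda>_. 0)"
  using assms unfolding near_zero_def by auto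

definition multi_indices :: "'p set \<Rightarrow> ('p \<Rightarrow> nat) set" where
  "multi_indices P = {m. \<forall>i. i \<notin> P \<longrightarrow> m i = 0}"

definition mdeg :: "'p set \<Rightarrow> ('p \<Rightarrow> nat) \<Rightarrow> nat" where
  "mdeg P m = (\<Sum>i\<in>P. m i)"

definition power_prod :: "'p set \<Rightarrow> ('p \<Rightarrow> 'a) \<Rightarrow> ('p \<Rightarrow> nat) \<Rightarrow> 'a :: comm_monoid_mult" where
  "power_prod P x m = (\<Prod>i\<in>P. x i ^ m i)"

lemma conv_power_series_iff:
  "conv_power_series P f \<longleftrightarrow>
    (\<exists>c. near_zero P (\<lambda>x. ((\<lambda>m. c m * power_prod P x m) has_sum f x) (multi_indices P)))"
  unfolding conv_power_series_def multi_indices_def power_prod_def ..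

lemma norm_power_prod_le:
  fixes x :: "'p \<Rightarrow> 'a :: real_normed_field"
  assumes "\<And>i. i \<in> P \<Longrightarrow> norm (x i) \<le> r"
  shows "norm (power_prod P x m) \<le> r ^ mdeg P m"
proof -
  have "norm (power_prod P x m) = (\<Prod>i\<in>P. norm (x i) ^ m i)"
    unfolding power_prod_def prod_norm[symmetric] by (simp only: norm_power)
  also have "\<dots> \<le> (\<Prod>i\<in>P. r ^ m i)"
    using assms by (intro prod_mono) (auto intro: power_mono)
  finally show ?thesis by (simp add: mdeg_def power_sum)
qed

lemma power_prod_const:
  fixes x :: "'a :: real_normed_field"
  shows "power_prod P (\<lambda>_. x) m = x ^ mdeg P m"
  unfolding power_prod_def mdeg_def by (simp add: power_sum)

lemma mdeg_0_iff: "finite P \<Longrightarrow> m \<in> multi_indices P \<Longrightarrow> mdeg P m = 0 \<longleftrightarrow> m = (\<lambda>_. 0)"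
  unfolding mdeg_def multi_indices_def by auto

lemma zero_in_multi_indices [simp]: "(\<lambda>_. 0) \<in> multi_indices P"
  unfolding multi_indices_def by auto

lemma finite_multi_indices_le:
  assumes "finite P"
  shows "finite {m \<in> multi_indices P. mdeg P m \<le> N}"
proof (rule finite_subset)
  show "{m \<in> multi_indices P. mdeg P m \<le> N} \<subseteq>
     {f. \<forall>x. (x \<in> P \<longrightarrow> f x \<in> {..N}) \<and> (x \<notin> P \<longrightarrow> f x = 0)}"
  proof safe
    fix m x assume m: "mdeg P m \<le> N" "x \<in> P"
    have "m x \<le> mdeg P m"
      unfolding mdeg_def using assms m by (intro member_le_sum) auto
    with m show "m x \<le> N" by simp
  qed (auto simp: multi_indices_def)
  show "finite \<dots>" using assms by (intro finite_set_of_finite_funs) auto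
qed

lemma summable_on_sum_family:
  fixes f :: "'i \<Rightarrow> 'b \<Rightarrow> 'c :: topological_comm_monoid_add"
  assumes "\<And>i. i \<in> I \<Longrightarrow> f i summable_on A"
  shows "(\<lambda>x. \<Sum>i\<in>I. f i x) summable_on A"
  using assms
  by (induction I rule: infinite_finite_induct) (auto intro: summable_on_add)

lemma has_sum_sum_family:
  fixes f :: "'i \<Rightarrow> 'b \<Rightarrow> 'c :: topological_comm_monoid_add"
  assumes "\<And>i. i \<in> I \<Longrightarrow> (f i has_sum s i) A"
  shows "((\<lambda>x. \<Sum>i\<in>I. f i x) has_sum (\<Sum>i\<in>I. s i)) A"
  using assms
  by (induction I rule: infinite_finite_induct) (auto intro: has_sum_add)

text \<open>In finite dimension unconditional summability is absolute summability. This is where the ground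
  field has to be \<open>\<real>\<close> or \<open>\<complex>\<close>: all estimates below work with absolute convergence.\<close>

lemma summable_on_imp_abs_summable_on:
  fixes f :: "'b \<Rightarrow> 'a :: euclidean_space"
  assumes "f summable_on A"
  shows "f abs_summable_on A"
proof -
  have b: "(\<lambda>x. \<bar>f x \<bullet> b\<bar>) summable_on A" for b
  proof -
    have "(\<lambda>x. f x \<bullet> b) summable_on A"
      using assms has_sum_bounded_linear[OF bounded_linear_inner_left] unfolding summable_on_def by blast
    then show ?thesis
      using summable_on_iff_abs_summable_on_real by force
  qed
  have "(\<lambda>x. \<Sum>b\<in>Basis. \<bar>f x \<bullet> b\<bar>) summable_on A"
    using b by (rule summable_on_sum_family)
  then show ?thesis
    by (rule abs_summable_on_comparison_test') (simp add: norm_le_l1)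
qed

text \<open>Convergence at the single point all of whose coordinates are \<open>r\<close> gives absolute convergence,
  with the weights \<open>r\<close> to the degree, on the whole closed polydisc of radius \<open>r\<close>.\<close>

lemma conv_power_series_abs_summable:
  fixes f :: "('p \<Rightarrow> 'a :: real_or_complex) \<Rightarrow> 'a"
  assumes "conv_power_series P f"
  obtains c r where "r > 0" "(\<lambda>m. norm (c m) * r ^ mdeg P m) summable_on multi_indices P"
    "\<And>x. (\<And>i. i \<in> P \<Longrightarrow> norm (x i) \<le> r) \<Longrightarrow>
       ((\<lambda>m. c m * power_prod P x m) has_sum f x) (multi_indices P)"
proof -
  obtain c R where R: "R > 0" and
    s: "\<And>x. (\<forall>i\<in>P. norm (x i) < R) \<Longrightarrow>
         ((\<lambda>m. c m * power_prod P x m) has_sum f x) (multi_indices P)"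
    using assms unfolding conv_power_series_iff near_zero_def by blast
  define r where "r = R / 2"
  have r: "r > 0" "r < R" using R by (auto simp: r_def)
  have "(\<lambda>m. c m * power_prod P (\<lambda>_. of_real r) m) summable_on multi_indices P"
    using s[of "\<lambda>_. of_real r"] r by (auto simp: summable_on_def)
  then have "(\<lambda>m. norm (c m * power_prod P (\<lambda>_. of_real r) m)) summable_on multi_indices P"
    by (rule summable_on_imp_abs_summable_on)
  moreover have "norm (c m * power_prod P (\<lambda>_. of_real r) m) = norm (c m) * r ^ mdeg P m" for m
    using r by (simp add: power_prod_const norm_mult norm_power)
  ultimately have "(\<lambda>m. norm (c m) * r ^ mdeg P m) summable_on multi_indices P" by simp
  with r show ?thesis
    by (intro that[of r c] s) (auto intro: le_less_trans)
qed

lemma abs_summable_power_prod: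
  fixes x :: "'p \<Rightarrow> 'a :: real_normed_field"
  assumes "(\<lambda>m. norm (c m) * r ^ mdeg P m) summable_on multi_indices P"
    "\<And>i. i \<in> P \<Longrightarrow> norm (x i) \<le> r"
  shows "(\<lambda>m. c m * power_prod P x m) abs_summable_on multi_indices P"
  using assms(1)
  by (rule abs_summable_on_comparison_test')
    (use assms(2) in \<open>auto simp: norm_mult intro!: mult_left_mono norm_power_prod_le\<close>)

lemma conv_power_series_infsum:
  fixes c :: "('p \<Rightarrow> nat) \<Rightarrow> 'a :: real_or_complex"
  assumes "r > 0" "(\<lambda>m. norm (c m) * r ^ mdeg P m) summable_on multi_indices P"
  shows "conv_power_series P (\<lambda>x. \<Sum>\<^sub>\<infinity>m\<in>multi_indices P. c m * power_prod P x m)"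
  unfolding conv_power_series_iff near_zero_def
proof (intro exI[of _ c] exI[of _ r] conjI allI impI)
  fix x :: "'p \<Rightarrow> 'a" assume "\<forall>i\<in>P. norm (x i) < r"
  then have "(\<lambda>m. c m * power_prod P x m) abs_summable_on multi_indices P"
    by (intro abs_summable_power_prod[OF assms(2)]) auto
  then show "((\<lambda>m. c m * power_prod P x m) has_sum
      (\<Sum>\<^sub>\<infinity>m\<in>multi_indices P. c m * power_prod P x m)) (multi_indices P)"
    by (rule has_sum_infsum[OF abs_summable_summable])
qed fact

lemma power_series_at_zero:
  fixes c :: "('p \<Rightarrow> nat) \<Rightarrow> 'a :: real_or_complex"
  assumes "finite P" "((\<lambda>m. c m * power_prod P (\<lambda>_. 0) m) has_sum s) (multi_indices P)"
  shows "c (\<lambda>_. 0) = s"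
proof -
  have "((\<lambda>m. c m * power_prod P (\<lambda>_. 0) m) has_sum c (\<lambda>_. 0)) (multi_indices P)"
  proof (rule has_sum_finite_neutralI[of "{\<lambda>_. 0}"])
    fix m assume m: "m \<in> multi_indices P - {\<lambda>_. 0}"
    then have "mdeg P m \<noteq> 0" using mdeg_0_iff[OF assms(1), of m] by auto
    then show "c m * power_prod P (\<lambda>_. 0) m = 0"
      by (simp add: power_prod_const zero_power)
  qed (auto simp: power_prod_def)
  then show ?thesis using assms(2) has_sum_unique by blast
qed

lemma conv_power_series_add:
  assumes "conv_power_series P f" "conv_power_series P g"
  shows "conv_power_series P (\<lambda>x. f x + g x)"
proof -
  obtain c d where
    c: "near_zero P (\<lambda>x. ((\<lambda>m. c m * power_prod P x m) has_sum f x) (multi_indices P))" and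
    d: "near_zero P (\<lambda>x. ((\<lambda>m. d m * power_prod P x m) has_sum g x) (multi_indices P))"
    using assms unfolding conv_power_series_iff by blast
  show ?thesis
    unfolding conv_power_series_iff
    by (rule exI[of _ "\<lambda>m. c m + d m"], rule near_zero_mono[OF near_zero_conj[OF c d]])
      (auto simp: ring_distribs intro!: has_sum_add)
qed

lemma conv_power_series_cmult:
  assumes "conv_power_series P f"
  shows "conv_power_series P (\<lambda>x. a * f x)"
proof -
  obtain c where
    c: "near_zero P (\<lambda>x. ((\<lambda>m. c m * power_prod P x m) has_sum f x) (multi_indices P))"
    using assms unfolding conv_power_series_iff by blast
  show ?thesis
    unfolding conv_power_series_iff
    by (rule exI[of _ "\<lambda>m. a * c m"], rule near_zero_mono[OF c])
      (auto simp: mult.assoc intro!: has_sum_cmult_right)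
qed

lemma conv_power_series_const:
  assumes "finite P"
  shows "conv_power_series P (\<lambda>_. a)"
  unfolding conv_power_series_iff
proof (intro exI near_zero_all)
  fix x :: "'a \<Rightarrow> 'b"
  show "((\<lambda>m. (if m = (\<lambda>_. 0) then a else 0) * power_prod P x m) has_sum a) (multi_indices P)"
    by (rule has_sum_finite_neutralI[of "{\<lambda>_. 0}"]) (auto simp: power_prod_def)
qed

definition unit_index :: "'p \<Rightarrow> 'p \<Rightarrow> nat" where
  "unit_index p = (\<lambda>i. if i = p then 1 else 0)"

lemma power_prod_unit_index:
  fixes x :: "'p \<Rightarrow> 'a :: comm_monoid_mult"
  assumes "finite P" "p \<in> P"
  shows "power_prod P x (unit_index p) = x p"
proof -
  have "power_prod P x (unit_index p) = (\<Prod>i\<in>P. if i = p then x i else 1)"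
    unfolding power_prod_def unit_index_def by (rule prod.cong) auto
  then show ?thesis using assms by simp
qed

lemma unit_index_in_multi_indices: "p \<in> P \<Longrightarrow> unit_index p \<in> multi_indices P"
  by (auto simp: unit_index_def multi_indices_def)

lemma conv_power_series_coord:
  assumes "finite P" "p \<in> P"
  shows "conv_power_series P (\<lambda>x. x p)"
  unfolding conv_power_series_iff
proof (intro exI near_zero_all)
  fix x :: "'a \<Rightarrow> 'b"
  show "((\<lambda>m. (if m = unit_index p then 1 else 0) * power_prod P x m) has_sum x p) (multi_indices P)"
    by (rule has_sum_finite_neutralI[of "{unit_index p}"])
      (use assms in \<open>auto simp: power_prod_unit_index unit_index_in_multi_indices\<close>)
qed

lemma conv_power_series_sum:
  assumes "finite P" "\<And>i. i \<in> I \<Longrightarrow> conv_power_series P (f i)"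
  shows "conv_power_series P (\<lambda>x. \<Sum>i\<in>I. f i x)"
  using assms(2)
proof (induction I rule: infinite_finite_induct)
  case (insert i I)
  then show ?case by (simp add: conv_power_series_add)
qed (auto intro: conv_power_series_const assms(1))

section \<open>First-order behaviour at the origin\<close>

lemma multi_indices_deg_1:
  assumes "finite P" "m \<in> multi_indices P" "mdeg P m < 2"
  shows "m = (\<lambda>_. 0) \<or> (\<exists>p\<in>P. m = unit_index p)"
proof (cases "m = (\<lambda>_. 0)")
  case False
  then have "mdeg P m = 1" using mdeg_0_iff[OF assms(1,2)] assms(3) by auto
  then obtain p where p: "p \<in> P" "m p = 1" "\<And>q. q \<in> P \<Longrightarrow> p \<noteq> q \<Longrightarrow> m q = 0"
    unfolding mdeg_def using sum_eq_1_iff[OF assms(1), of m] by auto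
  then have "m = unit_index p"
    using assms(2) by (auto simp: unit_index_def multi_indices_def fun_eq_iff)
  with p show ?thesis by blast
qed auto

text \<open>All monomials left after removing the affine part have degree at least \<open>2\<close>, so shrinking the
  polydisc by the factor \<open>t\<close> shrinks the absolutely convergent remainder by \<open>t\<^sup>2\<close>.\<close>

lemma power_series_first_order:
  fixes f :: "('p \<Rightarrow> 'a :: real_or_complex) \<Rightarrow> 'a"
  assumes P: "finite P" and f: "conv_power_series P f"
  shows "\<exists>r>0. \<exists>K\<ge>0. \<exists>d. \<forall>t x. 0 \<le> t \<and> t \<le> 1 \<and> (\<forall>i\<in>P. norm (x i) \<le> t * r) \<longrightarrow>
    norm (f x - f (\<lambda>_. 0) - (\<Sum>i\<in>P. d i * x i)) \<le> t^2 * K"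
proof -
  obtain c r where r: "r > 0" and c: "(\<lambda>m. norm (c m) * r ^ mdeg P m) summable_on multi_indices P"
    and s: "\<And>x. (\<And>i. i \<in> P \<Longrightarrow> norm (x i) \<le> r) \<Longrightarrow>
       ((\<lambda>m. c m * power_prod P x m) has_sum f x) (multi_indices P)"
    using conv_power_series_abs_summable[OF f] by blast
  define K where "K = (\<Sum>\<^sub>\<infinity>m\<in>multi_indices P. norm (c m) * r ^ mdeg P m)"
  define L where "L = insert (\<lambda>_. 0) (unit_index ` P)"
  have inj: "inj_on unit_index P"
    by (rule inj_onI) (auto simp: unit_index_def fun_eq_iff split: if_splits)
  have L: "finite L" "L \<subseteq> multi_indices P"
    using P by (auto simp: L_def unit_index_in_multi_indices)
  have c0: "c (\<lambda>_. 0) = f (\<lambda>_. 0)"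
    using r by (intro power_series_at_zero[OF P, where c = c] s) auto
  have "norm (f x - f (\<lambda>_. 0) - (\<Sum>i\<in>P. c (unit_index i) * x i)) \<le> t^2 * K"
    if t: "0 \<le> t" "t \<le> 1" and x: "\<And>i. i \<in> P \<Longrightarrow> norm (x i) \<le> t * r" for t x
  proof -
    have xr: "norm (x i) \<le> r" if "i \<in> P" for i
    proof -
      have "t * r \<le> 1 * r" using t r by (intro mult_right_mono) auto
      then show ?thesis using x[OF that] by linarith
    qed
    have z: "(\<lambda>_. 0) \<notin> unit_index ` P"
    proof
      assume "(\<lambda>_. 0) \<in> unit_index ` P"
      then obtain p where "(\<lambda>_ :: 'p. 0 :: nat) = unit_index p" by blast
      then have "0 = unit_index p p" by (rule fun_cong)
      then show False by (simp add: unit_index_def)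
    qed
    have "(\<Sum>m\<in>L. c m * power_prod P x m) = f (\<lambda>_. 0) + (\<Sum>i\<in>P. c (unit_index i) * x i)"
      unfolding L_def using P z
      by (simp add: sum.reindex[OF inj] c0 power_prod_unit_index) (simp add: power_prod_def)
    moreover have "((\<lambda>m. c m * power_prod P x m) has_sum
        (f x - (\<Sum>m\<in>L. c m * power_prod P x m))) (multi_indices P - L)"
      using L s[OF xr] by (intro has_sum_Diff has_sum_finite) auto
    ultimately have h: "((\<lambda>m. c m * power_prod P x m) has_sum
        (f x - f (\<lambda>_. 0) - (\<Sum>i\<in>P. c (unit_index i) * x i))) (multi_indices P - L)"
      by (simp add: algebra_simps)
    have c': "(\<lambda>m. norm (c m) * r ^ mdeg P m) summable_on (multi_indices P - L)"
      using c by (rule summable_on_subset_banach) auto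
    have "norm (f x - f (\<lambda>_. 0) - (\<Sum>i\<in>P. c (unit_index i) * x i))
        \<le> t^2 * (\<Sum>\<^sub>\<infinity>m\<in>multi_indices P - L. norm (c m) * r ^ mdeg P m)"
    proof (rule norm_infsum_le[OF h has_sum_cmult_right[OF has_sum_infsum[OF c']]])
      fix m assume m: "m \<in> multi_indices P - L"
      then have d: "mdeg P m \<ge> 2"
        using multi_indices_deg_1[OF P, of m] by (auto simp: L_def not_less[symmetric])
      have "norm (power_prod P x m) \<le> (t * r) ^ mdeg P m"
        using x by (rule norm_power_prod_le)
      also have "\<dots> \<le> t^2 * r ^ mdeg P m"
        using t r d by (simp add: power_mult_distrib power_decreasing mult_right_mono)
      finally show "norm (c m * power_prod P x m) \<le> t^2 * (norm (c m) * r ^ mdeg P m)"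
        by (simp add: norm_mult mult.left_commute mult_left_mono)
    qed
    also have "\<dots> \<le> t^2 * K"
      unfolding K_def using c c' r
      by (intro mult_left_mono infsum_mono_neutral) auto
    finally show ?thesis .
  qed
  moreover have "K \<ge> 0" unfolding K_def using r by (intro infsum_nonneg) auto
  ultimately show ?thesis using r
    by (intro exI[of _ r] conjI exI[of _ K] exI[of _ "\<lambda>i. c (unit_index i)"]) auto
qed

lemma conv_power_series_small:
  fixes f :: "('p \<Rightarrow> 'a :: real_or_complex) \<Rightarrow> 'a"
  assumes P: "finite P" and f: "conv_power_series P f" and f0: "f (\<lambda>_. 0) = 0" and e: "e > 0"
  shows "near_zero P (\<lambda>x. norm (f x) < e)"
proof -
  obtain r K d where r: "r > 0" and K: "K \<ge> 0" and
    b: "\<forall>t x. 0 \<le> t \<and> t \<le> 1 \<and> (\<forall>i\<in>P. norm (x i) \<le> t * r) \<longrightarrow>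
      norm (f x - f (\<lambda>_. 0) - (\<Sum>i\<in>P. d i * x i)) \<le> t^2 * K"
    using power_series_first_order[OF P f] by blast
  define D where "D = (\<Sum>i\<in>P. norm (d i)) * r"
  define t where "t = min 1 (e / (2 * (K + D + 1)))"
  have D: "D \<ge> 0" using r by (auto simp: D_def intro!: mult_nonneg_nonneg sum_nonneg)
  have t: "0 < t" "t \<le> 1" "t \<le> e / (2 * (K + D + 1))"
    using e K D by (auto simp: t_def)
  have "norm (f x) < e" if x: "\<forall>i\<in>P. norm (x i) < t * r" for x
  proof -
    have "norm (\<Sum>i\<in>P. d i * x i) \<le> (\<Sum>i\<in>P. norm (d i) * (t * r))"
      using x by (intro sum_norm_le) (auto simp: norm_mult intro!: mult_left_mono intro: less_imp_le)
    also have "\<dots> = t * D"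
      by (simp add: D_def sum_distrib_right[symmetric])
    finally have 1: "norm (\<Sum>i\<in>P. d i * x i) \<le> t * D" .
    have "norm (f x - f (\<lambda>_. 0) - (\<Sum>i\<in>P. d i * x i)) \<le> t^2 * K"
      using x t by (intro b[rule_format]) (auto intro: less_imp_le)
    also have "\<dots> \<le> t * K"
      using t K by (intro mult_right_mono) (auto simp: power2_eq_square mult_left_le)
    finally have "norm (f x) \<le> t * K + t * D"
      using 1 f0 norm_triangle_sub[of "f x" "\<Sum>i\<in>P. d i * x i"] by auto
    also have "\<dots> \<le> e / (2 * (K + D + 1)) * (K + D)"
      unfolding distrib_left[symmetric] using t K D by (intro mult_right_mono) auto
    also have "\<dots> = e * ((K + D) / (2 * (K + D + 1)))" by simp
    also have "\<dots> < e * 1"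
      using e K D by (intro mult_strict_left_mono) (auto simp: divide_less_eq)
    also have "\<dots> = e" by simp
    finally show ?thesis .
  qed
  then show ?thesis
    unfolding near_zero_def using t r by (intro exI[of _ "t * r"]) auto
qed

text \<open>Differentiability is expressed along curves: this avoids a norm on the space of parameters, whose
  coordinates outside \<open>P\<close> are meaningless, and it is exactly the chain rule needed for
  pull-backs.\<close>

definition gradient_at_0 ::
  "'p set \<Rightarrow> (('p \<Rightarrow> 'a) \<Rightarrow> 'a :: real_normed_field) \<Rightarrow> ('p \<Rightarrow> 'a) \<Rightarrow> bool" where
  "gradient_at_0 P f d \<longleftrightarrow>
    (\<forall>\<gamma> \<gamma>'. (\<forall>i\<in>P. \<gamma> i 0 = 0 \<and> (\<gamma> i has_field_derivative \<gamma>' i) (at 0)) \<longrightarrow>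
       ((\<lambda>z. f (\<lambda>i. \<gamma> i z)) has_field_derivative (\<Sum>i\<in>P. d i * \<gamma>' i)) (at 0))"

lemma conv_power_series_local:
  fixes f :: "('p \<Rightarrow> 'a :: real_or_complex) \<Rightarrow> 'a"
  assumes "conv_power_series P f"
  shows "near_zero P (\<lambda>x. \<forall>y. (\<forall>i\<in>P. y i = x i) \<longrightarrow> f y = f x)"
proof -
  obtain c r where r: "r > 0" and s: "\<forall>x. (\<forall>i\<in>P. norm (x i) < r) \<longrightarrow>
         ((\<lambda>m. c m * power_prod P x m) has_sum f x) (multi_indices P)"
    using assms unfolding conv_power_series_iff near_zero_def by blast
  have "f y = f x" if x: "\<forall>i\<in>P. norm (x i) < r" and y: "\<forall>i\<in>P. y i = x i" for x y
  proof -
    have "power_prod P y = power_prod P x"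
      using y by (auto simp: power_prod_def intro!: prod.cong)
    moreover have "((\<lambda>m. c m * power_prod P y m) has_sum f y) (multi_indices P)"
      using s x y by auto
    ultimately show ?thesis using s x has_sum_unique by metis
  qed
  then show ?thesis unfolding near_zero_def using r by blast
qed

lemma conv_power_series_gradient:
  fixes f :: "('p \<Rightarrow> 'a :: real_or_complex) \<Rightarrow> 'a"
  assumes P: "finite P" and f: "conv_power_series P f"
  shows "\<exists>d. gradient_at_0 P f d"
proof -
  obtain r K d where r: "r > 0" and K: "K \<ge> 0" and
    b: "\<forall>t x. 0 \<le> t \<and> t \<le> 1 \<and> (\<forall>i\<in>P. norm (x i) \<le> t * r) \<longrightarrow>
      norm (f x - f (\<lambda>_. 0) - (\<Sum>i\<in>P. d i * x i)) \<le> t^2 * K"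
    using power_series_first_order[OF P f] by blast
  have f0: "f (\<lambda>i. \<gamma> i 0) = f (\<lambda>_. 0)" if "\<forall>i\<in>P. \<gamma> i 0 = (0 :: 'a)" for \<gamma> :: "'p \<Rightarrow> 'a \<Rightarrow> 'a"
    using that by (intro near_zeroD0[OF conv_power_series_local[OF f], rule_format]) auto
  have "gradient_at_0 P f d"
    unfolding gradient_at_0_def
  proof (intro allI impI)
    fix \<gamma> :: "'p \<Rightarrow> 'a \<Rightarrow> 'a" and \<gamma>'
    assume g: "\<forall>i\<in>P. \<gamma> i 0 = 0 \<and> (\<gamma> i has_field_derivative \<gamma>' i) (at 0)"
    define e where "e z = f (\<lambda>i. \<gamma> i z) - f (\<lambda>_. 0) - (\<Sum>i\<in>P. d i * \<gamma> i z)" for z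
    (* Chosen so that all coordinates of the curve are eventually at most M r |z|; the first-order
       estimate then applies with t = M |z|. *)
    define M where "M = (\<Sum>i\<in>P. norm (\<gamma>' i) + 1) / r + 1"
    have "0 \<le> (\<Sum>i\<in>P. norm (\<gamma>' i) + 1) / r"
      using r by (intro divide_nonneg_pos sum_nonneg) auto
    then have M: "M > 0" unfolding M_def by linarith
    have Mi: "(norm (\<gamma>' i) + 1) \<le> M * r" if "i \<in> P" for i
    proof -
      have "norm (\<gamma>' i) + 1 \<le> (\<Sum>i\<in>P. norm (\<gamma>' i) + 1)"
        using P that by (intro member_le_sum) auto
      moreover have "M * r = (\<Sum>i\<in>P. norm (\<gamma>' i) + 1) + r"
        using r by (simp add: M_def distrib_right)
      ultimately show ?thesis using r by linarith
    qed
    have ev: "\<forall>\<^sub>F z in at 0. norm (\<gamma> i z) \<le> (norm (\<gamma>' i) + 1) * norm z" if "i \<in> P" for i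
    proof -
      have "((\<lambda>z. norm (\<gamma> i z / z)) \<longlongrightarrow> norm (\<gamma>' i)) (at 0)"
      proof (rule tendsto_norm)
        have "\<gamma> i 0 = 0" "(\<gamma> i has_field_derivative \<gamma>' i) (at 0)" using g that by auto
        then show "((\<lambda>z. \<gamma> i z / z) \<longlongrightarrow> \<gamma>' i) (at 0)"
          by (simp add: has_field_derivative_iff)
      qed
      then have "\<forall>\<^sub>F z in at 0. norm (\<gamma> i z / z) < norm (\<gamma>' i) + 1"
        by (rule order_tendstoD) simp
      moreover have "\<forall>\<^sub>F z in at (0::'a). z \<noteq> 0"
        by (rule eventually_neq_at_within)
      ultimately show ?thesis
        by eventually_elim (simp add: norm_divide field_simps)
    qed
    have ev_all: "\<forall>\<^sub>F z in at 0. \<forall>i\<in>P. norm (\<gamma> i z) \<le> (norm (\<gamma>' i) + 1) * norm z"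
      using ev P by (auto intro: eventually_ball_finite)
    have nz: "((\<lambda>z::'a. norm z) \<longlongrightarrow> 0) (at 0)"
      by (rule tendsto_norm_zero) (rule tendsto_ident_at)
    have "\<forall>\<^sub>F z in at (0::'a). norm z < 1 / M"
      using nz by (rule order_tendstoD) (use M in auto)
    with ev_all have eb: "\<forall>\<^sub>F z in at 0. norm (e z / z) \<le> norm z * (M^2 * K)"
    proof eventually_elim
      case (elim z)
      show ?case
      proof (cases "z = 0")
        case False
        have zM: "norm z * M \<le> 1" using elim M by (simp add: field_simps)
        have "norm (e z) \<le> (norm z * M)^2 * K"
          unfolding e_def
        proof (rule b[rule_format], intro conjI ballI)
          fix i assume i: "i \<in> P"
          have "norm (\<gamma> i z) \<le> (norm (\<gamma>' i) + 1) * norm z" using elim i by auto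
          also have "\<dots> \<le> M * r * norm z" using Mi[OF i] by (rule mult_right_mono) auto
          finally show "norm (\<gamma> i z) \<le> norm z * M * r" by (simp add: mult_ac)
        qed (use zM M in auto)
        then show ?thesis using False
          by (simp add: norm_divide divide_le_eq power2_eq_square mult_ac)
      qed auto
    qed
    have e0: "e 0 = 0" unfolding e_def using g f0[of \<gamma>] by simp
    have "((\<lambda>z. e z / z) \<longlongrightarrow> 0) (at 0)"
      by (rule Lim_null_comparison[OF eb]) (rule tendsto_mult_left_zero[OF nz])
    then have "(e has_field_derivative 0) (at 0)"
      by (simp add: has_field_derivative_iff e0)
    moreover have "((\<lambda>z. \<Sum>i\<in>P. d i * \<gamma> i z) has_field_derivative (\<Sum>i\<in>P. d i * \<gamma>' i)) (at 0)"
      using g by (intro DERIV_sum DERIV_cmult) auto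
    ultimately have "((\<lambda>z. e z + (f (\<lambda>_. 0) + (\<Sum>i\<in>P. d i * \<gamma> i z))) has_field_derivative
        0 + (0 + (\<Sum>i\<in>P. d i * \<gamma>' i))) (at 0)"
      by (intro DERIV_add DERIV_const)
    then show "((\<lambda>z. f (\<lambda>i. \<gamma> i z)) has_field_derivative (\<Sum>i\<in>P. d i * \<gamma>' i)) (at 0)"
      by (simp add: e_def algebra_simps)
  qed
  then show ?thesis by blast
qed

section \<open>Quadratic systems with power series coefficients\<close>

text \<open>The pairs \<open>(a, b)\<close> with \<open>a + b = m\<close> and both parts of smaller degree than \<open>m\<close>. For series
  without constant term the other pairs do not contribute to the Cauchy product.\<close>

definition lower_splits :: "'p set \<Rightarrow> ('p \<Rightarrow> nat) \<Rightarrow> (('p \<Rightarrow> nat) \<times> ('p \<Rightarrow> nat)) set" where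
  "lower_splits P m = {(a, b). a \<in> multi_indices P \<and> b \<in> multi_indices P \<and>
     (\<forall>i. a i + b i = m i) \<and> mdeg P a < mdeg P m \<and> mdeg P b < mdeg P m}"

text \<open>The coefficients of the only possible power series solution without constant term of
  \<open>w\<^sub>i = h\<^sub>i + \<Sum>\<^sub>j\<^sub>k g\<^sub>i\<^sub>j\<^sub>k w\<^sub>j w\<^sub>k\<close>, by recursion on the degree.\<close>

function quad_coeff :: "'p set \<Rightarrow> 'i set \<Rightarrow> ('i \<Rightarrow> 'i \<Rightarrow> 'i \<Rightarrow> 'a) \<Rightarrow> ('i \<Rightarrow> ('p \<Rightarrow> nat) \<Rightarrow> 'a) \<Rightarrow>
    'i \<Rightarrow> ('p \<Rightarrow> nat) \<Rightarrow> 'a :: real_normed_field" where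
  "quad_coeff P J g h i m = h i m + (\<Sum>j\<in>J. \<Sum>k\<in>J. g i j k *
     (\<Sum>ab\<in>lower_splits P m. quad_coeff P J g h j (fst ab) * quad_coeff P J g h k (snd ab)))"
  by auto
termination
  by (relation "Wellfounded.measure (\<lambda>(P, J, g, h, i, m). mdeg P m)") (auto simp: lower_splits_def)

declare quad_coeff.simps [simp del]

lemma mdeg_add: "(\<And>i. a i + b i = m i) \<Longrightarrow> mdeg P m = mdeg P a + mdeg P b"
  unfolding mdeg_def sum.distrib[symmetric] by (rule sum.cong) auto

lemma power_prod_add: "(\<And>i. a i + b i = m i) \<Longrightarrow> power_prod P x m = power_prod P x a * power_prod P x b"
  unfolding power_prod_def prod.distrib[symmetric] power_add[symmetric] by (rule prod.cong) auto

lemma lower_splits_0: "lower_splits P (\<lambda>_. 0) = {}"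
  by (auto simp: lower_splits_def mdeg_def)

lemma lower_splits_le:
  assumes "mdeg P m \<le> Suc N"
  shows "lower_splits P m \<subseteq> {a \<in> multi_indices P. mdeg P a \<le> N} \<times> {a \<in> multi_indices P. mdeg P a \<le> N}"
  using assms by (auto simp: lower_splits_def)

lemma finite_lower_splits: "finite P \<Longrightarrow> finite (lower_splits P m)"
  using lower_splits_le[of P m "mdeg P m"] finite_multi_indices_le[of P "mdeg P m"]
  by (auto intro: finite_subset)

text \<open>A pair determines the multi-index that it splits, so the double sum runs over distinct pairs of
  multi-indices of degree at most \<open>N\<close>.\<close>

lemma sum_lower_splits_le:
  fixes u v :: "('p \<Rightarrow> nat) \<Rightarrow> real"
  assumes P: "finite P" and u: "\<And>a. u a \<ge> 0" and v: "\<And>a. v a \<ge> 0"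
  defines "K \<equiv> \<lambda>N. {m \<in> multi_indices P. mdeg P m \<le> N}"
  shows "(\<Sum>m\<in>K (Suc N). \<Sum>ab\<in>lower_splits P m. u (fst ab) * v (snd ab)) \<le> (\<Sum>a\<in>K N. u a) * (\<Sum>b\<in>K N. v b)"
proof -
  have K: "finite (K N)" for N unfolding K_def by (rule finite_multi_indices_le[OF P])
  let ?S = "Sigma (K (Suc N)) (lower_splits P)"
  have inj: "inj_on snd ?S"
  proof (rule inj_onI)
    have fst: "fst z = (\<lambda>i. fst (snd z) i + snd (snd z) i)" if "z \<in> ?S" for z
      using that by (cases z) (auto simp: lower_splits_def fun_eq_iff)
    show "x = y" if "x \<in> ?S" "y \<in> ?S" "snd x = snd y" for x y
      using fst[OF that(1)] fst[OF that(2)] that(3) by (simp add: prod_eq_iff)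
  qed
  have sub: "snd ` ?S \<subseteq> K N \<times> K N"
    using lower_splits_le unfolding K_def by fastforce
  have "(\<Sum>m\<in>K (Suc N). \<Sum>ab\<in>lower_splits P m. u (fst ab) * v (snd ab)) =
      (\<Sum>x\<in>?S. u (fst (snd x)) * v (snd (snd x)))"
    using K finite_lower_splits[OF P] by (subst sum.Sigma) (auto simp: case_prod_beta)
  also have "\<dots> = (\<Sum>ab\<in>snd ` ?S. u (fst ab) * v (snd ab))"
    by (simp add: sum.reindex[OF inj])
  also have "\<dots> \<le> (\<Sum>ab\<in>K N \<times> K N. u (fst ab) * v (snd ab))"
    using K u v by (intro sum_mono2 sub) auto
  also have "\<dots> = (\<Sum>a\<in>K N. u a) * (\<Sum>b\<in>K N. v b)"
    by (simp add: sum_product sum.cartesian_product case_prod_beta)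
  finally show ?thesis .
qed

text \<open>Let \<open>W\<^sub>N\<close> be the weighted norm of the part of the solution of degree at most \<open>N\<close>. The recursion
  gives \<open>W\<^sub>N\<^sub>+\<^sub>1 \<le> \<delta> + C W\<^sub>N\<^sup>2\<close>, and \<open>4 C \<delta> \<le> 1\<close> makes the bound \<open>W\<^sub>N \<le> 2 \<delta>\<close>
  reproduce itself.\<close>

lemma quad_coeff_majorant:
  fixes h :: "'i \<Rightarrow> ('p \<Rightarrow> nat) \<Rightarrow> 'a :: real_normed_field"
  assumes P: "finite P" and J: "finite J" and r: "r > 0"
    and h0: "\<And>i. i \<in> J \<Longrightarrow> h i (\<lambda>_. 0) = 0"
    and h: "\<And>N. (\<Sum>i\<in>J. \<Sum>m | m \<in> multi_indices P \<and> mdeg P m \<le> N. norm (h i m) * r ^ mdeg P m) \<le> \<delta>"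
    and C: "C = (\<Sum>i\<in>J. \<Sum>j\<in>J. \<Sum>k\<in>J. norm (g i j k))" and \<delta>: "\<delta> \<ge> 0" "4 * C * \<delta> \<le> 1"
  shows "(\<Sum>i\<in>J. \<Sum>m | m \<in> multi_indices P \<and> mdeg P m \<le> N.
           norm (quad_coeff P J g h i m) * r ^ mdeg P m) \<le> 2 * \<delta>"
proof (induction N)
  define w where "w = quad_coeff P J g h"
  define K where "K N = {m \<in> multi_indices P. mdeg P m \<le> N}" for N
  define u where "u i m = norm (w i m) * r ^ mdeg P m" for i m
  define W where "W N = (\<Sum>i\<in>J. \<Sum>m\<in>K N. u i m)" for N
  have K: "finite (K N)" for N unfolding K_def by (rule finite_multi_indices_le[OF P])
  have u0: "u i m \<ge> 0" for i m using r by (simp add: u_def)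
  have C0: "C \<ge> 0" unfolding C by (intro sum_nonneg) auto
  {
    case 0
    have "K 0 = {\<lambda>_. 0}"
      using mdeg_0_iff[OF P] by (auto simp: K_def)
    moreover have "w i (\<lambda>_. 0) = 0" if "i \<in> J" for i
      unfolding w_def by (subst quad_coeff.simps) (simp add: lower_splits_0 h0 that)
    ultimately have "W 0 = 0" by (simp add: W_def u_def)
    then show ?case using \<delta> by (simp add: W_def u_def w_def K_def)
  next
    case (Suc N)
    then have IH: "W N \<le> 2 * \<delta>" by (simp add: W_def u_def w_def K_def)
    have W0: "W N \<ge> 0" unfolding W_def using u0 by (intro sum_nonneg)
    have Wj: "(\<Sum>m\<in>K N. u j m) \<le> W N" if "j \<in> J" for j
      unfolding W_def using J u0 that by (intro member_le_sum sum_nonneg) auto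
    have step: "u i m \<le> norm (h i m) * r ^ mdeg P m + (\<Sum>j\<in>J. \<Sum>k\<in>J. norm (g i j k) *
       (\<Sum>ab\<in>lower_splits P m. u j (fst ab) * u k (snd ab)))" for i m
    proof -
      have eq: "(\<Sum>ab\<in>lower_splits P m. norm (w j (fst ab)) * norm (w k (snd ab)) * r ^ mdeg P m) =
          (\<Sum>ab\<in>lower_splits P m. u j (fst ab) * u k (snd ab))" for j k
      proof (rule sum.cong)
        fix ab assume "ab \<in> lower_splits P m"
        then have "mdeg P m = mdeg P (fst ab) + mdeg P (snd ab)"
          by (intro mdeg_add) (auto simp: lower_splits_def)
        then show "norm (w j (fst ab)) * norm (w k (snd ab)) * r ^ mdeg P m = u j (fst ab) * u k (snd ab)"
          by (simp add: u_def power_add)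
      qed auto
      have "norm (w i m) \<le> norm (h i m) + (\<Sum>j\<in>J. \<Sum>k\<in>J. norm (g i j k) *
         (\<Sum>ab\<in>lower_splits P m. norm (w j (fst ab)) * norm (w k (snd ab))))"
        unfolding w_def
        by (subst quad_coeff.simps, rule order_trans[OF norm_triangle_ineq], rule add_left_mono)
          (intro sum_norm_le, auto simp: norm_mult intro!: mult_left_mono sum_norm_le)
      then have "u i m \<le> (norm (h i m) + (\<Sum>j\<in>J. \<Sum>k\<in>J. norm (g i j k) *
         (\<Sum>ab\<in>lower_splits P m. norm (w j (fst ab)) * norm (w k (snd ab))))) * r ^ mdeg P m"
        unfolding u_def using r by (intro mult_right_mono) auto
      also have "\<dots> = norm (h i m) * r ^ mdeg P m + (\<Sum>j\<in>J. \<Sum>k\<in>J. norm (g i j k) *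
         (\<Sum>ab\<in>lower_splits P m. norm (w j (fst ab)) * norm (w k (snd ab)) * r ^ mdeg P m))"
        by (simp add: distrib_right sum_distrib_right mult.assoc)
      also have "\<dots> = norm (h i m) * r ^ mdeg P m + (\<Sum>j\<in>J. \<Sum>k\<in>J. norm (g i j k) *
         (\<Sum>ab\<in>lower_splits P m. u j (fst ab) * u k (snd ab)))"
        by (simp only: eq)
      finally show ?thesis .
    qed
    have "W (Suc N) \<le> (\<Sum>i\<in>J. \<Sum>m\<in>K (Suc N). norm (h i m) * r ^ mdeg P m + (\<Sum>j\<in>J. \<Sum>k\<in>J. norm (g i j k) *
       (\<Sum>ab\<in>lower_splits P m. u j (fst ab) * u k (snd ab))))"
      unfolding W_def by (intro sum_mono step)
    also have "\<dots> = (\<Sum>i\<in>J. \<Sum>m\<in>K (Suc N). norm (h i m) * r ^ mdeg P m) +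
       (\<Sum>i\<in>J. \<Sum>m\<in>K (Suc N). \<Sum>j\<in>J. \<Sum>k\<in>J. norm (g i j k) *
         (\<Sum>ab\<in>lower_splits P m. u j (fst ab) * u k (snd ab)))"
      by (simp only: sum.distrib)
    also have "(\<Sum>i\<in>J. \<Sum>m\<in>K (Suc N). \<Sum>j\<in>J. \<Sum>k\<in>J. norm (g i j k) *
         (\<Sum>ab\<in>lower_splits P m. u j (fst ab) * u k (snd ab))) =
       (\<Sum>i\<in>J. \<Sum>j\<in>J. \<Sum>k\<in>J. norm (g i j k) *
         (\<Sum>m\<in>K (Suc N). \<Sum>ab\<in>lower_splits P m. u j (fst ab) * u k (snd ab)))"
    proof (rule sum.cong[OF refl])
      fix i
      have "(\<Sum>m\<in>K (Suc N). \<Sum>j\<in>J. \<Sum>k\<in>J. norm (g i j k) *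
         (\<Sum>ab\<in>lower_splits P m. u j (fst ab) * u k (snd ab))) =
         (\<Sum>j\<in>J. \<Sum>m\<in>K (Suc N). \<Sum>k\<in>J. norm (g i j k) *
         (\<Sum>ab\<in>lower_splits P m. u j (fst ab) * u k (snd ab)))"
        by (rule sum.swap)
      also have "\<dots> = (\<Sum>j\<in>J. \<Sum>k\<in>J. \<Sum>m\<in>K (Suc N). norm (g i j k) *
         (\<Sum>ab\<in>lower_splits P m. u j (fst ab) * u k (snd ab)))"
        by (rule sum.cong[OF refl]) (rule sum.swap)
      finally show "(\<Sum>m\<in>K (Suc N). \<Sum>j\<in>J. \<Sum>k\<in>J. norm (g i j k) *
         (\<Sum>ab\<in>lower_splits P m. u j (fst ab) * u k (snd ab))) = (\<Sum>j\<in>J. \<Sum>k\<in>J. norm (g i j k) *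
         (\<Sum>m\<in>K (Suc N). \<Sum>ab\<in>lower_splits P m. u j (fst ab) * u k (snd ab)))"
        by (simp only: sum_distrib_left)
    qed
    also have "(\<Sum>i\<in>J. \<Sum>m\<in>K (Suc N). norm (h i m) * r ^ mdeg P m) \<le> \<delta>"
      using h[of "Suc N"] by (simp add: K_def)
    also have "(\<Sum>i\<in>J. \<Sum>j\<in>J. \<Sum>k\<in>J. norm (g i j k) *
         (\<Sum>m\<in>K (Suc N). \<Sum>ab\<in>lower_splits P m. u j (fst ab) * u k (snd ab)))
       \<le> (\<Sum>i\<in>J. \<Sum>j\<in>J. \<Sum>k\<in>J. norm (g i j k) * (W N * W N))"
    proof (intro sum_mono mult_left_mono)
      fix j k assume jk: "j \<in> J" "k \<in> J"
      have "(\<Sum>m\<in>K (Suc N). \<Sum>ab\<in>lower_splits P m. u j (fst ab) * u k (snd ab))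
          \<le> (\<Sum>a\<in>K N. u j a) * (\<Sum>b\<in>K N. u k b)"
        unfolding K_def using u0 by (intro sum_lower_splits_le[OF P])
      also have "\<dots> \<le> W N * W N"
        using jk u0 W0 by (intro mult_mono Wj sum_nonneg) auto
      finally show "(\<Sum>m\<in>K (Suc N). \<Sum>ab\<in>lower_splits P m. u j (fst ab) * u k (snd ab)) \<le> W N * W N" .
    qed auto
    also have "(\<Sum>i\<in>J. \<Sum>j\<in>J. \<Sum>k\<in>J. norm (g i j k) * (W N * W N)) = C * (W N * W N)"
      by (simp only: C sum_distrib_right)
    also have "C * (W N * W N) \<le> C * (2 * \<delta> * (2 * \<delta>))"
      using C0 IH W0 \<delta> by (intro mult_left_mono mult_mono) auto
    also have "C * (2 * \<delta> * (2 * \<delta>)) = (4 * C * \<delta>) * \<delta>" by simp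
    also have "(4 * C * \<delta>) * \<delta> \<le> 1 * \<delta>" using \<delta> by (intro mult_right_mono)
    finally have "W (Suc N) \<le> 2 * \<delta>" by simp
    then show ?case by (simp add: W_def u_def w_def K_def)
  }
qed

lemma abs_summable_product_has_sum:
  fixes f :: "'b \<Rightarrow> 'a :: real_or_complex" and g :: "'c \<Rightarrow> 'a"
  assumes f: "f abs_summable_on A" and g: "g abs_summable_on B"
  shows "((\<lambda>x. f (fst x) * g (snd x)) has_sum (infsum f A * infsum g B)) (A \<times> B)"
proof (rule has_sum_SigmaI[where g = "\<lambda>x. f x * infsum g B"])
  show "((\<lambda>y. f (fst (x, y)) * g (snd (x, y))) has_sum f x * infsum g B) B" for x
    using has_sum_cmult_right[OF has_sum_infsum[OF abs_summable_summable[OF g]]] by simp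
  show "((\<lambda>x. f x * infsum g B) has_sum infsum f A * infsum g B) A"
    by (rule has_sum_cmult_left[OF has_sum_infsum[OF abs_summable_summable[OF f]]])
  have "(\<lambda>x. f (fst x) * g (snd x)) abs_summable_on A \<times> B"
    unfolding abs_summable_on_Sigma_iff
  proof (intro conjI ballI)
    fix x
    show "(\<lambda>y. f (fst (x, y)) * g (snd (x, y))) abs_summable_on B"
      unfolding fst_conv snd_conv norm_mult by (rule summable_on_cmult_right[OF g])
  next
    have "(\<Sum>\<^sub>\<infinity>y\<in>B. norm (f (fst (x, y)) * g (snd (x, y)))) = norm (f x) * (\<Sum>\<^sub>\<infinity>y\<in>B. norm (g y))" for x
      unfolding fst_conv snd_conv norm_mult by (rule infsum_cmult_right) (rule g)
    then show "(\<lambda>x. \<Sum>\<^sub>\<infinity>y\<in>B. norm (f (fst (x, y)) * g (snd (x, y)))) abs_summable_on A"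
      using summable_on_cmult_left[OF f, of "norm (\<Sum>\<^sub>\<infinity>y\<in>B. norm (g y))"] by (simp add: norm_mult abs_mult)
  qed
  then show "(\<lambda>x. f (fst x) * g (snd x)) summable_on A \<times> B" by (rule abs_summable_summable)
qed

text \<open>The product of the two sums is a sum over all pairs of multi-indices; grouping the pairs by
  their sum is legitimate by absolute convergence.\<close>

lemma cauchy_product_multi_indices:
  fixes c d :: "('p \<Rightarrow> nat) \<Rightarrow> 'a :: real_or_complex"
  assumes P: "finite P" and c0: "c (\<lambda>_. 0) = 0" and d0: "d (\<lambda>_. 0) = 0"
    and c: "(\<lambda>m. c m * power_prod P x m) abs_summable_on multi_indices P"
    and d: "(\<lambda>m. d m * power_prod P x m) abs_summable_on multi_indices P"
  shows "((\<lambda>m. (\<Sum>ab\<in>lower_splits P m. c (fst ab) * d (snd ab)) * power_prod P x m) has_sum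
    ((\<Sum>\<^sub>\<infinity>m\<in>multi_indices P. c m * power_prod P x m) * (\<Sum>\<^sub>\<infinity>m\<in>multi_indices P. d m * power_prod P x m)))
    (multi_indices P)"
proof -
  let ?M = "multi_indices P"
  define S where "S m = {(a, b). a \<in> ?M \<and> b \<in> ?M \<and> (\<forall>i. a i + b i = m i)}" for m :: "'p \<Rightarrow> nat"
  define F where "F ab = (c (fst ab) * power_prod P x (fst ab)) * (d (snd ab) * power_prod P x (snd ab))" for ab
  have finS: "finite (S m)" for m
  proof (rule finite_subset)
    show "S m \<subseteq> {a \<in> ?M. mdeg P a \<le> mdeg P m} \<times> {a \<in> ?M. mdeg P a \<le> mdeg P m}"
    proof (clarsimp simp: S_def)
      fix a b assume "\<forall>i. a i + b i = m i"
      then have "mdeg P m = mdeg P a + mdeg P b" by (intro mdeg_add) auto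
      then show "mdeg P a \<le> mdeg P m \<and> mdeg P b \<le> mdeg P m" by simp
    qed
  qed (auto intro: finite_multi_indices_le[OF P])
  have s1: "(F has_sum ((\<Sum>\<^sub>\<infinity>m\<in>?M. c m * power_prod P x m) * (\<Sum>\<^sub>\<infinity>m\<in>?M. d m * power_prod P x m))) (?M \<times> ?M)"
    unfolding F_def by (rule abs_summable_product_has_sum[OF c d])
  have s2: "((\<lambda>(m, ab). F ab) has_sum ((\<Sum>\<^sub>\<infinity>m\<in>?M. c m * power_prod P x m) *
      (\<Sum>\<^sub>\<infinity>m\<in>?M. d m * power_prod P x m))) (Sigma ?M S)"
  proof (rule iffD2[OF has_sum_reindex_bij_witness s1])
    show "(\<lambda>ab. (\<lambda>i. fst ab i + snd ab i, ab)) (snd y) = y" if "y \<in> Sigma ?M S" for y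
      using that by (auto simp: S_def fun_eq_iff)
  qed (auto simp: S_def multi_indices_def)
  have split: "(\<Sum>ab\<in>S m. F ab) = (\<Sum>ab\<in>lower_splits P m. c (fst ab) * d (snd ab)) * power_prod P x m"
    if m: "m \<in> ?M" for m
  proof -
    have "(\<Sum>ab\<in>S m. F ab) = (\<Sum>ab\<in>lower_splits P m. F ab)"
    proof (rule sum.mono_neutral_right[OF finS])
      show "lower_splits P m \<subseteq> S m" by (auto simp: lower_splits_def S_def)
      show "\<forall>ab\<in>S m - lower_splits P m. F ab = 0"
      proof
        fix ab assume ab: "ab \<in> S m - lower_splits P m"
        obtain a b where [simp]: "ab = (a, b)" by (cases ab)
        have M: "a \<in> ?M" "b \<in> ?M" using ab by (auto simp: S_def)
        have "mdeg P m = mdeg P a + mdeg P b" using ab by (intro mdeg_add) (auto simp: S_def)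
        moreover have "\<not> (mdeg P a < mdeg P m \<and> mdeg P b < mdeg P m)"
          using ab by (auto simp: S_def lower_splits_def)
        ultimately have "mdeg P a = 0 \<or> mdeg P b = 0" by auto
        then have "a = (\<lambda>_. 0) \<or> b = (\<lambda>_. 0)" using mdeg_0_iff[OF P] M by blast
        then show "F ab = 0" using c0 d0 by (auto simp: F_def)
      qed
    qed
    also have "\<dots> = (\<Sum>ab\<in>lower_splits P m. c (fst ab) * d (snd ab) * power_prod P x m)"
    proof (rule sum.cong)
      fix ab assume "ab \<in> lower_splits P m"
      then have "power_prod P x m = power_prod P x (fst ab) * power_prod P x (snd ab)"
        by (intro power_prod_add) (auto simp: lower_splits_def)
      then show "F ab = c (fst ab) * d (snd ab) * power_prod P x m" by (simp add: F_def)
    qed auto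
    finally show ?thesis by (simp add: sum_distrib_right)
  qed
  have "((\<lambda>m. \<Sum>ab\<in>S m. F ab) has_sum ((\<Sum>\<^sub>\<infinity>m\<in>?M. c m * power_prod P x m) *
      (\<Sum>\<^sub>\<infinity>m\<in>?M. d m * power_prod P x m))) ?M"
    by (rule has_sum_SigmaD[OF s2]) (simp add: finS)
  then show ?thesis
    by (rule iffD1[OF has_sum_cong, rotated]) (rule split)
qed

text \<open>Without a constant term every monomial gains at least one factor when the radius shrinks, so the
  weighted norm becomes as small as required by the majorant argument.\<close>

lemma conv_power_series_small_weight:
  fixes f :: "('p \<Rightarrow> 'a :: real_or_complex) \<Rightarrow> 'a"
  assumes P: "finite P" and f: "conv_power_series P f" and f0: "f (\<lambda>_. 0) = 0" and e: "e > 0"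
  shows "\<exists>c R. R > 0 \<and> c (\<lambda>_. 0) = 0 \<and> (\<forall>r. 0 < r \<and> r \<le> R \<longrightarrow>
    (\<lambda>m. norm (c m) * r ^ mdeg P m) summable_on multi_indices P \<and>
    (\<Sum>\<^sub>\<infinity>m\<in>multi_indices P. norm (c m) * r ^ mdeg P m) \<le> e \<and>
    (\<forall>x. (\<forall>i\<in>P. norm (x i) \<le> r) \<longrightarrow> ((\<lambda>m. c m * power_prod P x m) has_sum f x) (multi_indices P)))"
proof -
  obtain c R where R: "R > 0" and c: "(\<lambda>m. norm (c m) * R ^ mdeg P m) summable_on multi_indices P"
    and s: "\<And>x. (\<And>i. i \<in> P \<Longrightarrow> norm (x i) \<le> R) \<Longrightarrow>
       ((\<lambda>m. c m * power_prod P x m) has_sum f x) (multi_indices P)"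
    using conv_power_series_abs_summable[OF f] by blast
  define S where "S = (\<Sum>\<^sub>\<infinity>m\<in>multi_indices P. norm (c m) * R ^ mdeg P m)"
  have S: "S \<ge> 0" unfolding S_def using R by (intro infsum_nonneg) auto
  define t0 where "t0 = min 1 (e / (S + 1))"
  have t0: "0 < t0" "t0 \<le> 1" "t0 \<le> e / (S + 1)" using e S by (auto simp: t0_def)
  have c0: "c (\<lambda>_. 0) = 0"
    using power_series_at_zero[OF P s[of "\<lambda>_. 0"]] R f0 by simp
  have main: "(\<lambda>m. norm (c m) * r ^ mdeg P m) summable_on multi_indices P \<and>
      (\<Sum>\<^sub>\<infinity>m\<in>multi_indices P. norm (c m) * r ^ mdeg P m) \<le> e" if r: "0 < r" "r \<le> t0 * R" for r
  proof -
    define t where "t = r / R"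
    have t: "0 < t" "t \<le> t0" "r = t * R" using r R by (auto simp: t_def field_simps)
    have le: "norm (c m) * r ^ mdeg P m \<le> t * (norm (c m) * R ^ mdeg P m)" if m: "m \<in> multi_indices P" for m
    proof (cases "mdeg P m = 0")
      case True
      then show ?thesis using c0 mdeg_0_iff[OF P m] by simp
    next
      case False
      then have "t ^ mdeg P m \<le> t ^ 1" using t t0 by (intro power_decreasing) auto
      then have "norm (c m) * R ^ mdeg P m * t ^ mdeg P m \<le> norm (c m) * R ^ mdeg P m * t"
        using R by (intro mult_left_mono) auto
      then show ?thesis by (simp add: t(3) power_mult_distrib mult_ac)
    qed
    have st: "(\<lambda>m. t * (norm (c m) * R ^ mdeg P m)) summable_on multi_indices P"
      by (rule summable_on_cmult_right[OF c])
    have sr: "(\<lambda>m. norm (c m) * r ^ mdeg P m) summable_on multi_indices P"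
      by (rule summable_on_comparison_test[OF st]) (use le r in auto)
    have "(\<Sum>\<^sub>\<infinity>m\<in>multi_indices P. norm (c m) * r ^ mdeg P m) \<le>
        (\<Sum>\<^sub>\<infinity>m\<in>multi_indices P. t * (norm (c m) * R ^ mdeg P m))"
      using sr st le by (rule infsum_mono)
    also have "\<dots> = t * S" unfolding S_def by (rule infsum_cmult_right) (rule c)
    also have "\<dots> \<le> e / (S + 1) * S" using t t0 S by (intro mult_right_mono) auto
    also have "\<dots> \<le> e" using e S by (simp add: divide_le_eq)
    finally show ?thesis using sr by blast
  qed
  have "t0 * R \<le> R" using t0 R by simp
  then have "((\<lambda>m. c m * power_prod P x m) has_sum f x) (multi_indices P)"
    if "r \<le> t0 * R" "\<forall>i\<in>P. norm (x i) \<le> r" for r x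
    using that by (intro s) force
  then show ?thesis
    using main c0 t0 R by (intro exI[of _ c] exI[of _ "t0 * R"]) auto
qed

text \<open>The recursively defined coefficients satisfy the system as formal power series by construction.
  On a polydisc on which the series \<open>H\<close> have small weighted norm, the majorant estimate bounds all
  partial sums of the weighted norms of the solution, hence they converge absolutely there.\<close>

theorem quadratic_system_solution:
  fixes H :: "'i \<Rightarrow> ('p \<Rightarrow> 'a :: real_or_complex) \<Rightarrow> 'a"
  assumes P: "finite P" and J: "finite J"
    and H: "\<And>i. i \<in> J \<Longrightarrow> conv_power_series P (H i)" and H0: "\<And>i. i \<in> J \<Longrightarrow> H i (\<lambda>_. 0) = 0"
  shows "\<exists>w. (\<forall>i\<in>J. conv_power_series P (w i) \<and> w i (\<lambda>_. 0) = 0) \<and>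
    near_zero P (\<lambda>x. \<forall>i\<in>J. w i x = H i x + (\<Sum>j\<in>J. \<Sum>k\<in>J. g i j k * (w j x * w k x)))"
proof -
  let ?M = "multi_indices P"
  define C where "C = (\<Sum>i\<in>J. \<Sum>j\<in>J. \<Sum>k\<in>J. norm (g i j k))"
  have C: "C \<ge> 0" unfolding C_def by (intro sum_nonneg) auto
  (* Small enough for the majorant argument; C + 1 covers the case C = 0. *)
  define \<delta> where "\<delta> = 1 / (4 * (C + 1))"
  have \<delta>: "\<delta> > 0" "4 * C * \<delta> \<le> 1" using C by (auto simp: \<delta>_def)
  define e where "e = \<delta> / (real (card J) + 1)"
  have e: "e > 0" "real (card J) * e \<le> \<delta>" using \<delta> by (auto simp: e_def field_simps)
  have "\<forall>i\<in>J. \<exists>cR. snd cR > 0 \<and> fst cR (\<lambda>_. 0) = 0 \<and> (\<forall>r. 0 < r \<and> r \<le> snd cR \<longrightarrow>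
    (\<lambda>m. norm (fst cR m) * r ^ mdeg P m) summable_on ?M \<and>
    (\<Sum>\<^sub>\<infinity>m\<in>?M. norm (fst cR m) * r ^ mdeg P m) \<le> e \<and>
    (\<forall>x. (\<forall>i\<in>P. norm (x i) \<le> r) \<longrightarrow> ((\<lambda>m. fst cR m * power_prod P x m) has_sum H i x) ?M))"
    using conv_power_series_small_weight[OF P H H0 e(1)] by simp
  then obtain cR where cR: "\<forall>i\<in>J. snd (cR i) > 0 \<and> fst (cR i) (\<lambda>_. 0) = 0 \<and> (\<forall>r. 0 < r \<and> r \<le> snd (cR i) \<longrightarrow>
    (\<lambda>m. norm (fst (cR i) m) * r ^ mdeg P m) summable_on ?M \<and>
    (\<Sum>\<^sub>\<infinity>m\<in>?M. norm (fst (cR i) m) * r ^ mdeg P m) \<le> e \<and>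
    (\<forall>x. (\<forall>i\<in>P. norm (x i) \<le> r) \<longrightarrow> ((\<lambda>m. fst (cR i) m * power_prod P x m) has_sum H i x) ?M))"
    by (rule bchoice[THEN exE])
  define h where "h i = fst (cR i)" for i
  define r where "r = Min (insert 1 ((\<lambda>i. snd (cR i)) ` J))"
  have r: "r > 0" unfolding r_def using J cR by (subst Min_gr_iff) auto
  have rle: "r \<le> snd (cR i)" if "i \<in> J" for i unfolding r_def using J that by (intro Min_le) auto
  have h0: "h i (\<lambda>_. 0) = 0" if "i \<in> J" for i using cR that by (auto simp: h_def)
  have hs: "(\<lambda>m. norm (h i m) * r ^ mdeg P m) summable_on ?M"
    and he: "(\<Sum>\<^sub>\<infinity>m\<in>?M. norm (h i m) * r ^ mdeg P m) \<le> e" if "i \<in> J" for i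
    using cR that r rle[OF that] unfolding h_def by blast+
  have hH: "((\<lambda>m. h i m * power_prod P x m) has_sum H i x) ?M"
    if "i \<in> J" "\<forall>i\<in>P. norm (x i) \<le> r" for i x
    using cR that r rle[OF that(1)] unfolding h_def by blast
  define w where "w = quad_coeff P J g h"
  have maj: "(\<Sum>i\<in>J. \<Sum>m | m \<in> ?M \<and> mdeg P m \<le> N. norm (w i m) * r ^ mdeg P m) \<le> 2 * \<delta>" for N
    unfolding w_def
  proof (rule quad_coeff_majorant[OF P J r _ _ C_def less_imp_le[OF \<delta>(1)] \<delta>(2)])
    show "h i (\<lambda>_. 0) = 0" if "i \<in> J" for i by (rule h0[OF that])
    fix N
    have "(\<Sum>m | m \<in> ?M \<and> mdeg P m \<le> N. norm (h i m) * r ^ mdeg P m) \<le> e" if "i \<in> J" for i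
      using r by (intro order_trans[OF finite_sum_le_infsum[OF hs[OF that]] he[OF that]]
          finite_multi_indices_le[OF P]) auto
    then have "(\<Sum>i\<in>J. \<Sum>m | m \<in> ?M \<and> mdeg P m \<le> N. norm (h i m) * r ^ mdeg P m) \<le> (\<Sum>i\<in>J. e)"
      by (rule sum_mono)
    also have "\<dots> \<le> \<delta>" using e(2) by simp
    finally show "(\<Sum>i\<in>J. \<Sum>m | m \<in> ?M \<and> mdeg P m \<le> N. norm (h i m) * r ^ mdeg P m) \<le> \<delta>" .
  qed
  have ws: "(\<lambda>m. norm (w i m) * r ^ mdeg P m) summable_on ?M" if i: "i \<in> J" for i
  proof (rule nonneg_bdd_above_summable_on)
    show "bdd_above (sum (\<lambda>m. norm (w i m) * r ^ mdeg P m) ` {F. F \<subseteq> ?M \<and> finite F})"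
    proof (rule bdd_aboveI2)
      fix F assume F: "F \<in> {F. F \<subseteq> ?M \<and> finite F}"
      define N where "N = (\<Sum>m\<in>F. mdeg P m)"
      have "F \<subseteq> {m. m \<in> ?M \<and> mdeg P m \<le> N}"
        using F unfolding N_def by (auto intro!: member_le_sum)
      then have "(\<Sum>m\<in>F. norm (w i m) * r ^ mdeg P m) \<le>
          (\<Sum>m | m \<in> ?M \<and> mdeg P m \<le> N. norm (w i m) * r ^ mdeg P m)"
        using r by (intro sum_mono2 finite_multi_indices_le[OF P]) auto
      also have "\<dots> \<le> (\<Sum>i\<in>J. \<Sum>m | m \<in> ?M \<and> mdeg P m \<le> N. norm (w i m) * r ^ mdeg P m)"
        using i J r by (intro member_le_sum sum_nonneg) auto
      also have "\<dots> \<le> 2 * \<delta>" by (rule maj)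
      finally show "(\<Sum>m\<in>F. norm (w i m) * r ^ mdeg P m) \<le> 2 * \<delta>" .
    qed
  qed (use r in auto)
  have w0: "w i (\<lambda>_. 0) = 0" if "i \<in> J" for i
    unfolding w_def by (subst quad_coeff.simps) (simp add: lower_splits_0 h0 that)
  define v where "v i x = (\<Sum>\<^sub>\<infinity>m\<in>?M. w i m * power_prod P x m)" for i x
  have wx: "(\<lambda>m. w i m * power_prod P x m) abs_summable_on ?M"
    if "i \<in> J" "\<forall>i\<in>P. norm (x i) \<le> r" for i x
    using that by (intro abs_summable_power_prod[OF ws]) auto
  have v: "((\<lambda>m. w i m * power_prod P x m) has_sum v i x) ?M"
    if "i \<in> J" "\<forall>i\<in>P. norm (x i) \<le> r" for i x
    unfolding v_def by (rule has_sum_infsum[OF abs_summable_summable[OF wx[OF that]]])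
  have eq: "v i x = H i x + (\<Sum>j\<in>J. \<Sum>k\<in>J. g i j k * (v j x * v k x))"
    if i: "i \<in> J" and x: "\<forall>i\<in>P. norm (x i) \<le> r" for i x
  proof -
    have "((\<lambda>m. h i m * power_prod P x m + (\<Sum>j\<in>J. \<Sum>k\<in>J. g i j k *
        ((\<Sum>ab\<in>lower_splits P m. w j (fst ab) * w k (snd ab)) * power_prod P x m))) has_sum
        (H i x + (\<Sum>j\<in>J. \<Sum>k\<in>J. g i j k * (v j x * v k x)))) ?M"
      unfolding v_def
      by (intro has_sum_add hH[OF i x] has_sum_sum_family has_sum_cmult_right
          cauchy_product_multi_indices[OF P w0 w0 wx[OF _ x] wx[OF _ x]])
    moreover have "h i m * power_prod P x m + (\<Sum>j\<in>J. \<Sum>k\<in>J. g i j k *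
        ((\<Sum>ab\<in>lower_splits P m. w j (fst ab) * w k (snd ab)) * power_prod P x m)) =
        w i m * power_prod P x m" for m
      unfolding w_def
      by (subst (3) quad_coeff.simps) (simp add: distrib_right sum_distrib_right mult.assoc)
    ultimately show ?thesis using v[OF i x] by (simp add: has_sum_unique)
  qed
  have "v i (\<lambda>_. 0) = 0" if "i \<in> J" for i
    using power_series_at_zero[OF P v[OF that]] r w0[OF that] by simp
  moreover have "conv_power_series P (v i)" if "i \<in> J" for i
    unfolding v_def[abs_def] by (rule conv_power_series_infsum[OF r ws[OF that]])
  moreover have "near_zero P (\<lambda>x. \<forall>i\<in>J. v i x = H i x + (\<Sum>j\<in>J. \<Sum>k\<in>J. g i j k * (v j x * v k x)))"
    unfolding near_zero_def using r eq by (intro exI[of _ r]) (auto intro: less_imp_le)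
  ultimately show ?thesis by blast
qed

text \<open>Products of the unknowns with the known series \<open>H\<close> are admitted by treating \<open>H\<close> as further
  unknowns: the indices \<open>Inr i\<close> carry the equations \<open>v = H\<^sub>i\<close> without quadratic terms.\<close>

corollary perturbed_quadratic_system_solution:
  fixes H :: "'i \<Rightarrow> ('p \<Rightarrow> 'a :: real_or_complex) \<Rightarrow> 'a"
  assumes P: "finite P" and U: "finite U"
    and H: "\<And>i. i \<in> U \<Longrightarrow> conv_power_series P (H i)" and H0: "\<And>i. i \<in> U \<Longrightarrow> H i (\<lambda>_. 0) = 0"
  shows "\<exists>w. (\<forall>i\<in>U. conv_power_series P (w i) \<and> w i (\<lambda>_. 0) = 0) \<and>
    near_zero P (\<lambda>x. \<forall>i\<in>U. w i x = H i x + (\<Sum>j\<in>U. \<Sum>k\<in>U. b i j k * (w j x * H k x))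
      + (\<Sum>j\<in>U. \<Sum>k\<in>U. g i j k * (w j x * w k x)))"
proof -
  define G where "G i j k = (case (i, j, k) of (Inl i, Inl j, Inl k) \<Rightarrow> g i j k
    | (Inl i, Inl j, Inr k) \<Rightarrow> b i j k | _ \<Rightarrow> 0)" for i j k :: "'i + 'i"
  define H' where "H' = case_sum H H"
  have H': "conv_power_series P (H' i)" "H' i (\<lambda>_. 0) = 0" if "i \<in> U <+> U" for i
    using H H0 that by (auto simp: H'_def)
  obtain v where
    v: "\<forall>i\<in>U <+> U. conv_power_series P (v i) \<and> v i (\<lambda>_. 0) = 0" and
    eq: "near_zero P (\<lambda>x. \<forall>i\<in>U <+> U. v i x = H' i x + (\<Sum>j\<in>U <+> U. \<Sum>k\<in>U <+> U. G i j k * (v j x * v k x)))"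
    using quadratic_system_solution[where H = H' and g = G, OF P finite_Plus[OF U U] H'] by blast
  show ?thesis
  proof (intro exI[of _ "\<lambda>i. v (Inl i)"] conjI)
    show "\<forall>i\<in>U. conv_power_series P (v (Inl i)) \<and> v (Inl i) (\<lambda>_. 0) = 0" using v by auto
    show "near_zero P (\<lambda>x. \<forall>i\<in>U. v (Inl i) x = H i x + (\<Sum>j\<in>U. \<Sum>k\<in>U. b i j k * (v (Inl j) x * H k x))
      + (\<Sum>j\<in>U. \<Sum>k\<in>U. g i j k * (v (Inl j) x * v (Inl k) x)))"
    proof (rule near_zero_mono[OF eq], rule ballI)
      fix x i assume e: "\<forall>i\<in>U <+> U. v i x = H' i x + (\<Sum>j\<in>U <+> U. \<Sum>k\<in>U <+> U. G i j k * (v j x * v k x))"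
        and i: "i \<in> U"
      have r: "v (Inr k) x = H k x" if "k \<in> U" for k
        using e[rule_format, OF InrI[OF that]] by (simp add: G_def H'_def)
      have "v (Inl i) x = H i x + (\<Sum>j\<in>U. (\<Sum>k\<in>U. g i j k * (v (Inl j) x * v (Inl k) x)) +
          (\<Sum>k\<in>U. b i j k * (v (Inl j) x * v (Inr k) x)))"
        using e[rule_format, OF InlI[OF i]] U
        by (simp add: G_def H'_def sum.Plus)
      also have "(\<Sum>j\<in>U. (\<Sum>k\<in>U. g i j k * (v (Inl j) x * v (Inl k) x)) +
          (\<Sum>k\<in>U. b i j k * (v (Inl j) x * v (Inr k) x))) =
          (\<Sum>j\<in>U. \<Sum>k\<in>U. g i j k * (v (Inl j) x * v (Inl k) x)) +
          (\<Sum>j\<in>U. \<Sum>k\<in>U. b i j k * (v (Inl j) x * H k x))"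
        by (simp add: sum.distrib r cong: sum.cong)
      finally show "v (Inl i) x = H i x + (\<Sum>j\<in>U. \<Sum>k\<in>U. b i j k * (v (Inl j) x * H k x))
          + (\<Sum>j\<in>U. \<Sum>k\<in>U. g i j k * (v (Inl j) x * v (Inl k) x))"
        by simp
    qed
  qed
qed

section \<open>The tangent space of an orbit\<close>

definition arrow_entries :: "('v, 'e) pre_digraph \<Rightarrow> ('v \<Rightarrow> nat) \<Rightarrow> ('v \<Rightarrow> nat) \<Rightarrow> ('e \<times> nat \<times> nat) set" where
  "arrow_entries Q n m = {(a, i, j). a \<in> arcs Q \<and> i < n (head Q a) \<and> j < m (tail Q a)}"

lemma arrow_entries_Upsilon: "arrow_entries Q n n = Upsilon Q n"
  by (simp add: arrow_entries_def Upsilon_def)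

lemma finite_Upsilon:
  assumes "fin_digraph Q"
  shows "finite (Upsilon Q n)"
proof -
  have "Upsilon Q n \<subseteq> (SIGMA a:arcs Q. {..<n (head Q a)} \<times> {..<n (tail Q a)})"
    by (auto simp: Upsilon_def)
  then show ?thesis
    by (rule finite_subset) (intro finite_SigmaI finite_cartesian_product finite_lessThan
        fin_digraph.finite_arcs[OF assms])
qed

text \<open>The operator \<open>X \<mapsto> X B - A X\<close>, arrow by arrow. For \<open>A = B\<close> its image is the tangent space at \<open>A\<close>
  of the orbit of \<open>A\<close>; the case \<open>A \<noteq> B\<close> describes an off-diagonal block of that space. The
  matrix \<open>X\<close> at the vertex \<open>v\<close> is a function of two indices, of which only those below \<open>n v\<close> and
  \<open>m v\<close> matter; so the matrices of all sizes form one vector space.\<close>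

definition sylvester ::
  "('v, 'e) pre_digraph \<Rightarrow> ('v \<Rightarrow> nat) \<Rightarrow> ('v \<Rightarrow> nat) \<Rightarrow> ('e, 'a) rep \<Rightarrow> ('e, 'a) rep \<Rightarrow>
   ('v \<Rightarrow> nat \<Rightarrow> nat \<Rightarrow> 'a) \<Rightarrow> 'e \<times> nat \<times> nat \<Rightarrow> 'a :: comm_ring_1" where
  "sylvester Q n m A B X = (\<lambda>(a, i, j).
     (\<Sum>k<m (head Q a). X (head Q a) i k * B a $$ (k, j)) -
     (\<Sum>k<n (tail Q a). A a $$ (i, k) * X (tail Q a) k j))"

lemma sylvester_cong:
  assumes "h \<in> arrow_entries Q n m"
    "\<And>v i j. i < n v \<Longrightarrow> j < m v \<Longrightarrow> X v i j = Y v i j"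
  shows "sylvester Q n m A B X h = sylvester Q n m A B Y h"
  using assms by (auto simp: sylvester_def arrow_entries_def intro!: arg_cong2[of _ _ _ _ "(-)"] sum.cong)

lemma sylvester_add:
  "sylvester Q n m A B (\<lambda>v i j. X v i j + Y v i j) h = sylvester Q n m A B X h + sylvester Q n m A B Y h"
  by (cases h) (simp add: sylvester_def sum.distrib ring_distribs)

lemma sylvester_cmult:
  "sylvester Q n m A B (\<lambda>v i j. c * X v i j) h = c * sylvester Q n m A B X h"
  by (cases h) (simp add: sylvester_def sum_distrib_left right_diff_distrib mult_ac)

lemma sylvester_zero: "sylvester Q n m A B (\<lambda>v i j. 0) h = 0"
  by (cases h) (simp add: sylvester_def)

lemma sylvester_sum:
  "sylvester Q n m A B (\<lambda>v i j. \<Sum>g\<in>G. c g * X g v i j) h = (\<Sum>g\<in>G. c g * sylvester Q n m A B (X g) h)"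
  by (induction G rule: infinite_finite_induct)
    (simp_all add: sylvester_zero sylvester_add sylvester_cmult)

text \<open>The image of the Sylvester operator is a linear complement of the space of representations
  supported on \<open>\<Gamma>\<close>. Equivalently, restricting the image to the entries outside \<open>\<Gamma>\<close> is a bijection;
  the two conjuncts are surjectivity and injectivity of this restriction.\<close>

definition transversal ::
  "('v, 'e) pre_digraph \<Rightarrow> ('v \<Rightarrow> nat) \<Rightarrow> ('v \<Rightarrow> nat) \<Rightarrow> ('e, 'a :: comm_ring_1) rep \<Rightarrow> ('e, 'a) rep \<Rightarrow>
   ('e \<times> nat \<times> nat) set \<Rightarrow> bool" where
  "transversal Q n m A B \<Gamma> \<longleftrightarrow>
     (\<forall>C. \<exists>X. \<forall>h\<in>arrow_entries Q n m - \<Gamma>. sylvester Q n m A B X h = C h) \<and>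
     (\<forall>X. (\<forall>h\<in>arrow_entries Q n m - \<Gamma>. sylvester Q n m A B X h = 0) \<longrightarrow>
        (\<forall>h\<in>arrow_entries Q n m. sylvester Q n m A B X h = 0))"

section \<open>Direct sums\<close>

lemma offset_0 [simp]: "offset n 0 v = 0"
  and offset_Suc [simp]: "offset n (Suc p) v = offset n p v + n p v"
  by (simp_all add: offset_def)

lemma offset_mono: "p \<le> q \<Longrightarrow> offset n p v \<le> offset n q v"
  unfolding offset_def by (rule sum_mono2) auto

lemma offset_add_less: "p < s \<Longrightarrow> i < n p v \<Longrightarrow> offset n p v + i < offset n s v"
  using offset_mono[of "Suc p" s n v] by simp

lemma offset_decompose:
  "i < offset n s v \<Longrightarrow> \<exists>p<s. \<exists>i'<n p v. i = offset n p v + i'"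
proof (induction s)
  case (Suc s)
  show ?case
  proof (cases "i < offset n s v")
    case True
    with Suc.IH show ?thesis using less_Suc_eq by blast
  next
    case False
    with Suc.prems show ?thesis
      by (intro exI[of _ s] conjI exI[of _ "i - offset n s v"]) auto
  qed
qed simp

definition block_of :: "(nat \<Rightarrow> 'v \<Rightarrow> nat) \<Rightarrow> 'v \<Rightarrow> nat \<Rightarrow> nat" where
  "block_of n v i = (LEAST p. i < offset n (Suc p) v)"

lemma block_of_offset:
  assumes "i < n p v"
  shows "block_of n v (offset n p v + i) = p"
  unfolding block_of_def
proof (rule Least_equality)
  fix q assume "offset n p v + i < offset n (Suc q) v"
  then show "p \<le> q" using offset_mono[of "Suc q" p n v] by (rule_tac ccontr) auto
qed (use assms in simp)

lemma sum_lessThan_add: "(\<Sum>k<a + b. f k) = (\<Sum>k<a. f k) + (\<Sum>k<(b::nat). f (a + k))"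
  for f :: "nat \<Rightarrow> 'a :: comm_monoid_add"
  by (induction b) (simp_all add: add.assoc)

lemma sum_offset:
  "(\<Sum>k<offset n s v. f k) = (\<Sum>p<s. \<Sum>k<n p v. f (offset n p v + k))"
  for f :: "nat \<Rightarrow> 'a :: comm_monoid_add"
  by (induction s) (simp_all add: sum_lessThan_add)

lemma diag_block_mat_offset:
  fixes M :: "nat \<Rightarrow> 'a :: zero mat"
  assumes M: "\<And>p. p < s \<Longrightarrow> M p \<in> carrier_mat (r p u) (c p v)"
  shows "diag_block_mat (map M [0..<s]) \<in> carrier_mat (offset r s u) (offset c s v) \<and>
    (\<forall>p<s. \<forall>q<s. \<forall>i<r p u. \<forall>j<c q v.
      diag_block_mat (map M [0..<s]) $$ (offset r p u + i, offset c q v + j) = (if p = q then M p $$ (i, j) else 0))"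
  using M
proof (induction s)
  case 0
  then show ?case by simp
next
  case (Suc s)
  define D where "D = diag_block_mat (map M [0..<s])"
  have IH: "D \<in> carrier_mat (offset r s u) (offset c s v) \<and>
    (\<forall>p<s. \<forall>q<s. \<forall>i<r p u. \<forall>j<c q v.
      D $$ (offset r p u + i, offset c q v + j) = (if p = q then M p $$ (i, j) else 0))"
    unfolding D_def by (rule Suc.IH) (simp add: Suc.prems)
  then have D: "D \<in> carrier_mat (offset r s u) (offset c s v)" by (rule conjunct1)
  have De: "D $$ (offset r p u + i, offset c q v + j) = (if p = q then M p $$ (i, j) else 0)"
    if "p < s" "q < s" "i < r p u" "j < c q v" for p q i j
    using IH that by blast
  have Ms: "M s \<in> carrier_mat (r s u) (c s v)" using Suc.prems by simp
  have eq: "diag_block_mat (map M [0..<Suc s]) =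
      four_block_mat D (0\<^sub>m (offset r s u) (c s v)) (0\<^sub>m (r s u) (offset c s v)) (M s)"
    using D Ms by (simp add: diag_block_mat_last Let_def D_def)
  show ?case
    unfolding eq
  proof (intro conjI allI impI)
    show "four_block_mat D (0\<^sub>m (offset r s u) (c s v)) (0\<^sub>m (r s u) (offset c s v)) (M s)
        \<in> carrier_mat (offset r (Suc s) u) (offset c (Suc s) v)"
      using D Ms by simp
    fix p q i j assume pq: "p < Suc s" "q < Suc s" and ij: "i < r p u" "j < c q v"
    have "offset r p u + i < offset r (Suc s) u" "offset c q v + j < offset c (Suc s) v"
      using pq ij by (simp_all only: offset_add_less)
    moreover have "offset r p u + i < offset r s u \<longleftrightarrow> p < s"
      using pq ij offset_add_less[of p s i r u] by (auto simp: less_Suc_eq)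
    moreover have "offset c q v + j < offset c s v \<longleftrightarrow> q < s"
      using pq ij offset_add_less[of q s j c v] by (auto simp: less_Suc_eq)
    ultimately show "four_block_mat D (0\<^sub>m (offset r s u) (c s v)) (0\<^sub>m (r s u) (offset c s v)) (M s)
        $$ (offset r p u + i, offset c q v + j) = (if p = q then M p $$ (i, j) else 0)"
      using D Ms pq ij De[of p q i j] by (auto simp: less_Suc_eq)
  qed
qed

lemma rep_sum_carrier:
  assumes "\<And>p. p < s \<Longrightarrow> is_rep Q (n p) (A p)" "a \<in> arcs Q"
  shows "rep_sum (map A [0..<s]) a \<in> carrier_mat (offset n s (head Q a)) (offset n s (tail Q a))"
  using diag_block_mat_offset[of s "\<lambda>p. A p a" n "head Q a" n "tail Q a"] assms
  by (auto simp: rep_sum_def is_rep_def comp_def)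

lemma rep_sum_index:
  assumes "\<And>p. p < s \<Longrightarrow> is_rep Q (n p) (A p)" "a \<in> arcs Q"
    "p < s" "q < s" "i < n p (head Q a)" "j < n q (tail Q a)"
  shows "rep_sum (map A [0..<s]) a $$ (offset n p (head Q a) + i, offset n q (tail Q a) + j) =
    (if p = q then A p a $$ (i, j) else 0)"
  using diag_block_mat_offset[of s "\<lambda>p. A p a" n "head Q a" n "tail Q a"] assms
  by (auto simp: rep_sum_def is_rep_def comp_def)

text \<open>Since \<open>A\<close> is block diagonal, the block \<open>(p, q)\<close> of \<open>X A - A X\<close> involves only the block \<open>(p, q)\<close>
  of \<open>X\<close>.\<close>

lemma sylvester_rep_sum:
  assumes A: "\<And>p. p < s \<Longrightarrow> is_rep Q (n p) (A p)" and a: "a \<in> arcs Q"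
    and pq: "p < s" "q < s" and ij: "i < n p (head Q a)" "j < n q (tail Q a)"
  shows "sylvester Q (offset n s) (offset n s) (rep_sum (map A [0..<s])) (rep_sum (map A [0..<s])) X
      (a, offset n p (head Q a) + i, offset n q (tail Q a) + j) =
    sylvester Q (n p) (n q) (A p) (A q) (\<lambda>v i j. X v (offset n p v + i) (offset n q v + j)) (a, i, j)"
proof -
  let ?S = "rep_sum (map A [0..<s]) a"
  note S_index = rep_sum_index[where n = n and A = A and s = s and Q = Q, OF A a]
  let ?h = "head Q a" and ?t = "tail Q a"
  have "(\<Sum>k<offset n s ?h. X ?h (offset n p ?h + i) k * ?S $$ (k, offset n q ?t + j)) =
      (\<Sum>r<s. \<Sum>k<n r ?h. X ?h (offset n p ?h + i) (offset n r ?h + k) * ?S $$ (offset n r ?h + k, offset n q ?t + j))"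
    by (rule sum_offset)
  also have "\<dots> = (\<Sum>r<s. if r = q then \<Sum>k<n q ?h. X ?h (offset n p ?h + i) (offset n q ?h + k) * A q a $$ (k, j) else 0)"
    by (rule sum.cong) (auto simp: S_index pq(2) ij(2))
  also have "\<dots> = (\<Sum>k<n q ?h. X ?h (offset n p ?h + i) (offset n q ?h + k) * A q a $$ (k, j))"
    using pq by simp
  finally have 1: "(\<Sum>k<offset n s ?h. X ?h (offset n p ?h + i) k * ?S $$ (k, offset n q ?t + j)) = \<dots>" .
  have "(\<Sum>k<offset n s ?t. ?S $$ (offset n p ?h + i, k) * X ?t k (offset n q ?t + j)) =
      (\<Sum>r<s. \<Sum>k<n r ?t. ?S $$ (offset n p ?h + i, offset n r ?t + k) * X ?t (offset n r ?t + k) (offset n q ?t + j))"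
    by (rule sum_offset)
  also have "\<dots> = (\<Sum>r<s. if r = p then \<Sum>k<n p ?t. A p a $$ (i, k) * X ?t (offset n p ?t + k) (offset n q ?t + j) else 0)"
    by (rule sum.cong) (auto simp: S_index pq(1) ij(1))
  also have "\<dots> = (\<Sum>k<n p ?t. A p a $$ (i, k) * X ?t (offset n p ?t + k) (offset n q ?t + j))"
    using pq by simp
  finally have 2: "(\<Sum>k<offset n s ?t. ?S $$ (offset n p ?h + i, k) * X ?t k (offset n q ?t + j)) = \<dots>" .
  show ?thesis by (simp add: sylvester_def 1 2)
qed

definition block_entries ::
  "('v, 'e) pre_digraph \<Rightarrow> (nat \<Rightarrow> 'v \<Rightarrow> nat) \<Rightarrow> nat \<Rightarrow> nat \<Rightarrow> ('e \<times> nat \<times> nat) set \<Rightarrow> ('e \<times> nat \<times> nat) set" where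
  "block_entries Q n p q \<Gamma> = {(a, i, j) \<in> arrow_entries Q (n p) (n q).
     (a, offset n p (head Q a) + i, offset n q (tail Q a) + j) \<in> \<Gamma>}"

definition glue_blocks ::
  "(nat \<Rightarrow> 'v \<Rightarrow> nat) \<Rightarrow> (nat \<Rightarrow> nat \<Rightarrow> 'v \<Rightarrow> nat \<Rightarrow> nat \<Rightarrow> 'a) \<Rightarrow> 'v \<Rightarrow> nat \<Rightarrow> nat \<Rightarrow> 'a" where
  "glue_blocks n Y v i j = (let p = block_of n v i; q = block_of n v j in
     Y p q v (i - offset n p v) (j - offset n q v))"

lemma glue_blocks_offset:
  "i < n p v \<Longrightarrow> j < n q v \<Longrightarrow> glue_blocks n Y v (offset n p v + i) (offset n q v + j) = Y p q v i j"
  by (simp add: glue_blocks_def block_of_offset)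

text \<open>The Sylvester operator of a direct sum is the direct sum of the operators of its blocks, and so is
  its restriction to the entries outside \<open>\<Gamma>\<close>; a direct sum of linear maps is bijective exactly if all
  summands are.\<close>

lemma transversal_rep_sum:
  fixes A :: "nat \<Rightarrow> ('e, 'a :: comm_ring_1) rep"
  assumes A: "\<And>p. p < s \<Longrightarrow> is_rep Q (n p) (A p)"
  shows "transversal Q (offset n s) (offset n s) (rep_sum (map A [0..<s])) (rep_sum (map A [0..<s])) \<Gamma> \<longleftrightarrow>
    (\<forall>p<s. \<forall>q<s. transversal Q (n p) (n q) (A p) (A q) (block_entries Q n p q \<Gamma>))"
    (is "?L \<longleftrightarrow> ?R")
proof -
  let ?N = "offset n s" and ?S = "rep_sum (map A [0..<s])"
  let ?T = "sylvester Q ?N ?N ?S ?S"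
  let ?e = "\<lambda>p q (a, i, j). (a, offset n p (head Q a) + i, offset n q (tail Q a) + j)"
  have dec: "\<exists>p<s. \<exists>q<s. \<exists>g\<in>arrow_entries Q (n p) (n q). h = ?e p q g" if h: "h \<in> arrow_entries Q ?N ?N" for h
  proof -
    obtain a I J where [simp]: "h = (a, I, J)" by (cases h)
    obtain p i where "p < s" "i < n p (head Q a)" "I = offset n p (head Q a) + i"
      using h offset_decompose[of I n s "head Q a"] by (auto simp: arrow_entries_def)
    moreover obtain q j where "q < s" "j < n q (tail Q a)" "J = offset n q (tail Q a) + j"
      using h offset_decompose[of J n s "tail Q a"] by (auto simp: arrow_entries_def)
    ultimately show ?thesis
      using h by (intro exI[of _ p] conjI exI[of _ q] bexI[of _ "(a, i, j)"]) (auto simp: arrow_entries_def)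
  qed
  have enc: "?e p q g \<in> arrow_entries Q ?N ?N" "(?e p q g \<in> \<Gamma>) = (g \<in> block_entries Q n p q \<Gamma>)"
    if "p < s" "q < s" "g \<in> arrow_entries Q (n p) (n q)" for p q g
    using that by (auto simp: arrow_entries_def block_entries_def offset_add_less)
  have syl: "?T X (?e p q g) = sylvester Q (n p) (n q) (A p) (A q)
      (\<lambda>v i j. X v (offset n p v + i) (offset n q v + j)) g"
    if "p < s" "q < s" "g \<in> arrow_entries Q (n p) (n q)" for X p q g
    using that by (auto simp: arrow_entries_def intro!: sylvester_rep_sum A)
  have glue: "?T (glue_blocks n Y) (?e p q g) = sylvester Q (n p) (n q) (A p) (A q) (Y p q) g"
    if pqg: "p < s" "q < s" "g \<in> arrow_entries Q (n p) (n q)" for Y p q g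
    unfolding syl[OF pqg] by (rule sylvester_cong[OF pqg(3)]) (rule glue_blocks_offset)
  show ?thesis
  proof
    assume L: ?L
    show ?R
    proof (intro allI impI)
      fix p q assume pq: "p < s" "q < s"
      show "transversal Q (n p) (n q) (A p) (A q) (block_entries Q n p q \<Gamma>)"
        unfolding transversal_def
      proof (intro conjI allI impI)
        fix C :: "'e \<times> nat \<times> nat \<Rightarrow> 'a"
        obtain X where X: "\<forall>h\<in>arrow_entries Q ?N ?N - \<Gamma>.
            ?T X h = (\<lambda>(a, i, j). C (a, i - offset n p (head Q a), j - offset n q (tail Q a))) h"
          using L unfolding transversal_def by meson
        show "\<exists>X. \<forall>g\<in>arrow_entries Q (n p) (n q) - block_entries Q n p q \<Gamma>.
            sylvester Q (n p) (n q) (A p) (A q) X g = C g"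
        proof (intro exI ballI)
          fix g assume g: "g \<in> arrow_entries Q (n p) (n q) - block_entries Q n p q \<Gamma>"
          then have "?e p q g \<in> arrow_entries Q ?N ?N - \<Gamma>" using enc[OF pq, of g] by blast
          then have "?T X (?e p q g) = C g" using X by (cases g) auto
          then show "sylvester Q (n p) (n q) (A p) (A q)
              (\<lambda>v i j. X v (offset n p v + i) (offset n q v + j)) g = C g"
            using g syl[OF pq] by simp
        qed
      next
        fix X assume X: "\<forall>g\<in>arrow_entries Q (n p) (n q) - block_entries Q n p q \<Gamma>.
            sylvester Q (n p) (n q) (A p) (A q) X g = 0"
        (* Extend X by zero blocks, so that its image vanishes outside the block (p, q). *)
        define Y where "Y p' q' = (if p' = p \<and> q' = q then X else (\<lambda>_ _ _. 0))" for p' q'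
        have "?T (glue_blocks n Y) h = 0" if h: "h \<in> arrow_entries Q ?N ?N - \<Gamma>" for h
        proof -
          obtain p' q' g where g: "p' < s" "q' < s" "g \<in> arrow_entries Q (n p') (n q')" "h = ?e p' q' g"
            using dec h by blast
          then have "g \<notin> block_entries Q n p' q' \<Gamma>" using enc(2)[OF g(1-3)] h by blast
          then show ?thesis unfolding g(4) glue[OF g(1-3)] using X g
            by (auto simp: Y_def sylvester_zero)
        qed
        then have "?T (glue_blocks n Y) h = 0" if "h \<in> arrow_entries Q ?N ?N" for h
          using L that unfolding transversal_def by blast
        then show "\<forall>g\<in>arrow_entries Q (n p) (n q). sylvester Q (n p) (n q) (A p) (A q) X g = 0"
          using enc(1)[OF pq] glue[OF pq, of _ Y] by (auto simp: Y_def)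
      qed
    qed
  next
    assume R: ?R
    show ?L
      unfolding transversal_def
    proof (intro conjI allI impI)
      fix C :: "'e \<times> nat \<times> nat \<Rightarrow> 'a"
      define Y where "Y p q = (SOME X. \<forall>g\<in>arrow_entries Q (n p) (n q) - block_entries Q n p q \<Gamma>.
          sylvester Q (n p) (n q) (A p) (A q) X g = C (?e p q g))" for p q
      have Y: "\<forall>g\<in>arrow_entries Q (n p) (n q) - block_entries Q n p q \<Gamma>.
          sylvester Q (n p) (n q) (A p) (A q) (Y p q) g = C (?e p q g)"
        if "p < s" "q < s" for p q
      proof -
        have "\<forall>C. \<exists>X. \<forall>g\<in>arrow_entries Q (n p) (n q) - block_entries Q n p q \<Gamma>.
            sylvester Q (n p) (n q) (A p) (A q) X g = C g"
          using R that unfolding transversal_def by blast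
        from spec[OF this, of "\<lambda>g. C (?e p q g)"] show ?thesis
          unfolding Y_def by (rule someI_ex)
      qed
      have "?T (glue_blocks n Y) h = C h" if h: "h \<in> arrow_entries Q ?N ?N - \<Gamma>" for h
      proof -
        obtain p q g where g: "p < s" "q < s" "g \<in> arrow_entries Q (n p) (n q)" "h = ?e p q g"
          using dec h by blast
        then have "g \<notin> block_entries Q n p q \<Gamma>" using enc(2)[OF g(1-3)] h by blast
        then show ?thesis unfolding g(4) glue[OF g(1-3)] using Y g by blast
      qed
      then show "\<exists>X. \<forall>h\<in>arrow_entries Q ?N ?N - \<Gamma>. ?T X h = C h" by blast
    next
      fix X assume X: "\<forall>h\<in>arrow_entries Q ?N ?N - \<Gamma>. ?T X h = 0"
      show "\<forall>h\<in>arrow_entries Q ?N ?N. ?T X h = 0"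
      proof
        fix h assume "h \<in> arrow_entries Q ?N ?N"
        then obtain p q g where g: "p < s" "q < s" "g \<in> arrow_entries Q (n p) (n q)" "h = ?e p q g"
          using dec by blast
        let ?X = "\<lambda>v i j. X v (offset n p v + i) (offset n q v + j)"
        have "sylvester Q (n p) (n q) (A p) (A q) ?X g' = 0"
          if "g' \<in> arrow_entries Q (n p) (n q) - block_entries Q n p q \<Gamma>" for g'
          using that X enc[OF g(1,2), of g'] syl[OF g(1,2), of g' X] by fastforce
        then have "sylvester Q (n p) (n q) (A p) (A q) ?X g = 0"
          using R g unfolding transversal_def by blast
        then show "?T X h = 0" unfolding g(4) syl[OF g(1-3)] .
      qed
    qed
  qed
qed

section \<open>Fewer equations than unknowns\<close>

text \<open>Gaussian elimination: solve the last equation for one unknown and substitute.\<close>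

lemma underdetermined_system:
  fixes y :: "'g \<Rightarrow> nat \<Rightarrow> 'a :: field"
  assumes "finite G" "k < card G"
  shows "\<exists>c. (\<exists>g\<in>G. c g \<noteq> 0) \<and> (\<forall>i<k. (\<Sum>g\<in>G. c g * y g i) = 0)"
  using assms
proof (induction k arbitrary: G y)
  case 0
  then obtain g where "g \<in> G" by (metis card_gt_0_iff ex_in_conv)
  then show ?case by (intro exI[of _ "\<lambda>_. 1"]) auto
next
  case (Suc k)
  show ?case
  proof (cases "\<exists>g0\<in>G. y g0 k \<noteq> 0")
    case False
    obtain c where "\<exists>g\<in>G. c g \<noteq> 0" "\<forall>i<k. (\<Sum>g\<in>G. c g * y g i) = 0"
      using Suc.IH[of G y] Suc.prems by auto
    then show ?thesis using False by (intro exI[of _ c]) (auto simp: less_Suc_eq)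
  next
    case True
    then obtain g0 where g0: "g0 \<in> G" "y g0 k \<noteq> 0" by blast
    define G' where "G' = G - {g0}"
    have G': "finite G'" "k < card G'" "g0 \<notin> G'" "G = insert g0 G'"
      using Suc.prems g0 by (auto simp: G'_def)
    obtain c where c: "\<exists>g\<in>G'. c g \<noteq> 0"
      "\<forall>i<k. (\<Sum>g\<in>G'. c g * (y g i - y g k / y g0 k * y g0 i)) = 0"
      using Suc.IH[of G' "\<lambda>g i. y g i - y g k / y g0 k * y g0 i"] G' by blast
    define c0 where "c0 = - (\<Sum>g\<in>G'. c g * y g k) / y g0 k"
    define c' where "c' = c(g0 := c0)"
    have "(\<Sum>g\<in>G'. c' g * y g i) = (\<Sum>g\<in>G'. c g * y g i)" for i
      using G' by (intro sum.cong) (auto simp: c'_def)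
    then have s: "(\<Sum>g\<in>G. c' g * y g i) = c0 * y g0 i + (\<Sum>g\<in>G'. c g * y g i)" for i
      using G' by (simp add: c'_def)
    have "(\<Sum>g\<in>G. c' g * y g i) = 0" if "i < Suc k" for i
    proof (cases "i = k")
      case True
      then show ?thesis using g0 s by (simp add: c0_def)
    next
      case False
      then have "(\<Sum>g\<in>G'. c g * (y g i - y g k / y g0 k * y g0 i)) = 0" using c that by auto
      moreover have "c0 * y g0 i = - (\<Sum>g\<in>G'. c g * (y g k / y g0 k * y g0 i))"
        by (simp add: c0_def sum_divide_distrib sum_distrib_right mult.assoc)
      ultimately show ?thesis by (simp add: s right_diff_distrib sum_subtractf)
    qed
    moreover have "\<exists>g\<in>G. c' g \<noteq> 0" using c G' by (auto simp: c'_def)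
    ultimately show ?thesis by blast
  qed
qed

section \<open>Coordinates that span modulo the tangent space give a versal family\<close>

lemma elem_comb_carrier: "elem_comb Q n \<Gamma> \<epsilon> a \<in> carrier_mat (n (head Q a)) (n (tail Q a))"
  by (simp add: elem_comb_def)

lemma elem_comb_index:
  assumes "finite \<Gamma>" "i < n (head Q a)" "j < n (tail Q a)"
  shows "elem_comb Q n \<Gamma> \<epsilon> a $$ (i, j) = (if (a, i, j) \<in> \<Gamma> then \<epsilon> (a, i, j) else 0)"
proof -
  have "elem_comb Q n \<Gamma> \<epsilon> a $$ (i, j) =
      (\<Sum>(a', i', j')\<in>\<Gamma>. \<epsilon> (a', i', j') * elem_rep Q n a' i' j' a $$ (i, j))"
    using assms by (simp add: elem_comb_def)
  also have "\<dots> = (\<Sum>g\<in>\<Gamma>. if g = (a, i, j) then \<epsilon> g else 0)"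
    using assms by (intro sum.cong) (auto simp: elem_rep_def split: if_splits)
  finally show ?thesis using assms(1) by simp
qed

text \<open>The matrix is strictly diagonally dominant: for a nonzero kernel vector, the equation in the row of a largest
  entry would be contradictory.\<close>

lemma near_identity_inverse:
  fixes X :: "nat \<Rightarrow> nat \<Rightarrow> 'a :: real_normed_field"
  assumes X: "\<And>i j. i < k \<Longrightarrow> j < k \<Longrightarrow> norm (X i j) < 1 / (real k + 1)"
  defines "S \<equiv> Matrix.mat k k (\<lambda>(i, j). (if i = j then 1 else 0) + X i j)"
  shows "\<exists>T\<in>carrier_mat k k. inverts_mat S T \<and> inverts_mat T S"
proof -
  have S: "S \<in> carrier_mat k k" by (simp add: S_def)
  have "det S \<noteq> 0"
  proof
    assume "det S = 0"
    then obtain v where v: "v \<in> carrier_vec k" "v \<noteq> 0\<^sub>v k" "S *\<^sub>v v = 0\<^sub>v k"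
      using det_0_iff_vec_prod_zero_field[OF S] by blast
    define f where "f i = norm (vec_index v i)" for i
    obtain i1 where i1: "i1 < k" "vec_index v i1 \<noteq> 0"
      using v(1,2) by (metis carrier_vecD eq_vecI index_zero_vec)
    have "Max (f ` {..<k}) \<in> f ` {..<k}" using i1 by (intro Max_in) auto
    then obtain i0 where i0: "i0 < k" "Max (f ` {..<k}) = f i0" by auto
    have fm: "f j \<le> f i0" if "j < k" for j
      unfolding i0(2)[symmetric] using that by (intro Max_ge) auto
    have "f i1 > 0" using i1(2) by (simp add: f_def)
    then have f0: "f i0 > 0" using fm[OF i1(1)] by linarith
    have "0 = vec_index (S *\<^sub>v v) i0" using v i0 by simp
    also have "\<dots> = (\<Sum>j\<in>{0..<k}. ((if i0 = j then 1 else 0) + X i0 j) * vec_index v j)"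
      using v(1) i0(1) by (simp add: S_def scalar_prod_def)
    also have "\<dots> = vec_index v i0 + (\<Sum>j\<in>{0..<k}. X i0 j * vec_index v j)"
      using i0 by (simp add: distrib_right sum.distrib if_distrib[of "\<lambda>c. c * _"] cong: if_cong)
    finally have "norm (vec_index v i0) = norm (\<Sum>j\<in>{0..<k}. X i0 j * vec_index v j)"
      by (metis add_eq_0_iff norm_minus_cancel)
    also have "\<dots> \<le> (\<Sum>j\<in>{0..<k}. 1 / (real k + 1) * f i0)"
    proof (rule sum_norm_le)
      fix j assume "j \<in> {0..<k}"
      then show "norm (X i0 j * vec_index v j) \<le> 1 / (real k + 1) * f i0"
        using X[OF i0(1), of j] fm[of j] unfolding norm_mult f_def by (intro mult_mono) auto
    qed
    also have "\<dots> = real k / (real k + 1) * f i0" by simp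
    also have "\<dots> < 1 * f i0" using f0 by (intro mult_strict_right_mono) auto
    finally show False by (simp add: f_def)
  qed
  then have "S \<in> Units (ring_mat TYPE('a) k ())" by (rule det_non_zero_imp_unit[OF S])
  then obtain T where "T \<in> carrier_mat k k" "T * S = 1\<^sub>m k" "S * T = 1\<^sub>m k"
    unfolding Units_def ring_mat_def by auto
  then show ?thesis using S by (intro bexI[of _ T]) (auto simp: inverts_mat_def)
qed

lemma index_mult_mat_sum:
  assumes "A \<in> carrier_mat r s" "B \<in> carrier_mat s c" "i < r" "j < c"
  shows "(A * B) $$ (i, j) = (\<Sum>k<s. A $$ (i, k) * B $$ (k, j))"
  using assms by (simp add: scalar_prod_def atLeast0LessThan)

lemma sum_Upsilon_column:
  assumes U: "finite (Upsilon Q n)" and a: "a \<in> arcs Q" "j < n (tail Q a)"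
    and z: "\<And>b k l. b \<noteq> a \<or> l \<noteq> j \<Longrightarrow> f (b, k, l) = 0"
  shows "(\<Sum>h\<in>Upsilon Q n. f h) = (\<Sum>k<n (head Q a). f (a, k, j))"
proof -
  have "(\<Sum>h\<in>Upsilon Q n. f h) = (\<Sum>h\<in>(\<lambda>k. (a, k, j)) ` {..<n (head Q a)}. f h)"
  proof (rule sum.mono_neutral_right[OF U])
    show "(\<lambda>k. (a, k, j)) ` {..<n (head Q a)} \<subseteq> Upsilon Q n"
      using a by (auto simp: Upsilon_def)
    show "\<forall>h\<in>Upsilon Q n - (\<lambda>k. (a, k, j)) ` {..<n (head Q a)}. f h = 0"
      by (auto simp: Upsilon_def intro!: z)
  qed
  also have "\<dots> = (\<Sum>k<n (head Q a). f (a, k, j))"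
    by (subst sum.reindex) (auto simp: inj_on_def)
  finally show ?thesis .
qed

text \<open>For a deformation \<open>A - H\<close> one looks for \<open>S = I + X\<close> and \<open>\<Phi>\<close> supported on \<open>\<Gamma>\<close> with
  \<open>(A + \<Phi>) S = S (A - H)\<close>, that is \<open>(X A - A X) - \<Phi> = H + X H + \<Phi> X\<close>. By assumption the linear
  left-hand side maps onto all representations; choosing a preimage \<open>(Z\<^sub>h, D\<^sub>h)\<close> of every elementary
  representation \<open>E\<^sub>h\<close> and putting \<open>X = \<Sum>\<^sub>h w\<^sub>h Z\<^sub>h\<close> and \<open>\<Phi> = \<Sum>\<^sub>h w\<^sub>h D\<^sub>h\<close> turns the left-hand side
  into \<open>w\<close>, and the equation into a quadratic system for \<open>w\<close>.\<close>

lemma versal_of_spanning: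
  fixes A :: "('e, 'a :: real_or_complex) rep" and Q :: "('v, 'e) pre_digraph"
  assumes Q: "fin_digraph Q" and A: "is_rep Q n A" and \<Gamma>: "\<Gamma> \<subseteq> Upsilon Q n" and \<pi>: "bij_betw \<pi> \<Gamma> P"
    and span: "\<And>C. \<exists>X. \<forall>h\<in>Upsilon Q n - \<Gamma>. sylvester Q n n A A X h = C h"
    and F: "\<And>x a. a \<in> arcs Q \<Longrightarrow> F x a = A a + elem_comb Q n \<Gamma> (\<lambda>g. x (\<pi> g)) a"
  shows "versal Q n A P F"
  unfolding versal_def
proof (intro conjI allI impI)
  let ?U = "Upsilon Q n"
  have U: "finite ?U" by (rule finite_Upsilon[OF Q])
  have fin\<Gamma>: "finite \<Gamma>" using \<Gamma> U by (rule finite_subset)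
  have P: "finite P" using fin\<Gamma> \<pi> bij_betw_finite by blast
  have Ac: "A a \<in> carrier_mat (n (head Q a)) (n (tail Q a))" if "a \<in> arcs Q" for a
    using A that by (auto simp: is_rep_def)
  have Fc: "F x a \<in> carrier_mat (n (head Q a)) (n (tail Q a))" if "a \<in> arcs Q" for x a
    unfolding F[OF that] using elem_comb_carrier by (rule add_carrier_mat)
  have Fi: "F x a $$ (i, j) = A a $$ (i, j) + (if (a, i, j) \<in> \<Gamma> then x (\<pi> (a, i, j)) else 0)"
    if "a \<in> arcs Q" "i < n (head Q a)" "j < n (tail Q a)" for x a i j
    unfolding F[OF that(1)] using that elem_comb_carrier[of Q n \<Gamma> "\<lambda>g. x (\<pi> g)" a]
    by (simp add: elem_comb_index[OF fin\<Gamma>])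
  show "is_deformation Q n A P F"
    unfolding is_deformation_def conv_power_series_mat_def
  proof (intro conjI ballI allI impI)
    fix a assume a: "a \<in> arcs Q"
    show "near_zero P (\<lambda>x. F x a \<in> carrier_mat (n (head Q a)) (n (tail Q a)))"
      by (rule near_zero_all) (rule Fc[OF a])
    show "conv_power_series P (\<lambda>x. F x a $$ (i, j))" if "i < n (head Q a)" "j < n (tail Q a)" for i j
    proof (cases "(a, i, j) \<in> \<Gamma>")
      case True
      then have "\<pi> (a, i, j) \<in> P" using \<pi> by (auto simp: bij_betw_def)
      then show ?thesis using True
        by (simp add: Fi[OF a that] conv_power_series_add conv_power_series_const[OF P] conv_power_series_coord[OF P])
    next
      case False
      then show ?thesis by (simp add: Fi[OF a that] conv_power_series_const[OF P])
    qed
    show "F (\<lambda>_. 0) a = A a"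
      using Fc[OF a, of "\<lambda>_. 0"] Ac[OF a] by (intro eq_matI) (auto simp: Fi[OF a])
  qed (rule P)
  fix l :: nat and G :: "(nat \<Rightarrow> 'a) \<Rightarrow> ('e, 'a) rep"
  assume G: "is_deformation Q n A {..<l} G"
  let ?L = "{..<l}"
  have L: "finite ?L" by simp
  define H where "H = (\<lambda>(a, i, j) x. A a $$ (i, j) + (-1) * (G x a $$ (i, j)))"
  have H: "conv_power_series ?L (H h)" and H0: "H h (\<lambda>_. 0) = 0" if h: "h \<in> ?U" for h
  proof -
    obtain a i j where [simp]: "h = (a, i, j)" by (cases h)
    have "conv_power_series ?L (\<lambda>x. G x a $$ (i, j))" "G (\<lambda>_. 0) a = A a"
      using G h by (auto simp: is_deformation_def conv_power_series_mat_def Upsilon_def)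
    then show "conv_power_series ?L (H h)" "H h (\<lambda>_. 0) = 0"
      using conv_power_series_add[OF conv_power_series_const[OF L, of "A a $$ (i, j)"]
          conv_power_series_cmult[of ?L _ "-1"]]
      by (simp_all add: H_def)
  qed
  define Z where "Z h = (SOME X. \<forall>g\<in>?U - \<Gamma>. sylvester Q n n A A X g = (if g = h then 1 else 0))" for h
  have Z: "\<forall>g\<in>?U - \<Gamma>. sylvester Q n n A A (Z h) g = (if g = h then 1 else 0)" for h
    unfolding Z_def by (rule someI_ex[OF span])
  (* The defect of Z h as a preimage of the elementary representation at h. It is supported on the
     given coordinate set, hence can be compensated by parameters. *)
  define D where "D h g = sylvester Q n n A A (Z h) g - (if g = h then 1 else 0)" for h g
  have D0: "D h g = 0" if "g \<in> ?U" "g \<notin> \<Gamma>" for h g using Z that by (simp add: D_def)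
  define b :: "'e \<times> nat \<times> nat \<Rightarrow> 'e \<times> nat \<times> nat \<Rightarrow> 'e \<times> nat \<times> nat \<Rightarrow> 'a"
    where "b = (\<lambda>(a, i, j) h1 (a', k, j'). if a' = a \<and> j' = j then Z h1 (head Q a) i k else 0)"
  define c where "c = (\<lambda>(a, i, j) h1 h2. \<Sum>k<n (tail Q a). D h1 (a, i, k) * Z h2 (tail Q a) k j)"
  obtain w where w: "\<forall>h\<in>?U. conv_power_series ?L (w h) \<and> w h (\<lambda>_. 0) = 0"
    and weq: "near_zero ?L (\<lambda>x. \<forall>h\<in>?U. w h x = H h x + (\<Sum>h1\<in>?U. \<Sum>h2\<in>?U. b h h1 h2 * (w h1 x * H h2 x))
      + (\<Sum>h1\<in>?U. \<Sum>h2\<in>?U. c h h1 h2 * (w h1 x * w h2 x)))"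
    using perturbed_quadratic_system_solution[where H = H and b = b and g = c, OF L U H H0] by blast
  define X where "X v i j x = (\<Sum>h\<in>?U. Z h v i j * w h x)" for v i j x
  define \<Phi> where "\<Phi> g x = (\<Sum>h\<in>?U. D h g * w h x)" for g x
  define \<phi> where "\<phi> p = \<Phi> (the_inv_into \<Gamma> \<pi> p)" for p
  define S where "S v x = Matrix.mat (n v) (n v) (\<lambda>(i, j). (if i = j then 1 else 0) + X v i j x)" for v x
  have inv\<pi>: "the_inv_into \<Gamma> \<pi> (\<pi> g) = g" if "g \<in> \<Gamma>" for g
    using \<pi> that by (auto simp: bij_betw_def the_inv_into_f_f)
  have cX: "conv_power_series ?L (X v i j)" and X0: "X v i j (\<lambda>_. 0) = 0" for v i j
    using w unfolding X_def by (auto intro!: conv_power_series_sum conv_power_series_cmult)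
  have c\<Phi>: "conv_power_series ?L (\<Phi> g)" and \<Phi>0: "\<Phi> g (\<lambda>_. 0) = 0" for g
    using w unfolding \<Phi>_def by (auto intro!: conv_power_series_sum conv_power_series_cmult)
  have Sc: "S v x \<in> carrier_mat (n v) (n v)" for v x by (simp add: S_def)
  have key: "F (\<lambda>i. \<phi> i x) a * S (tail Q a) x = S (head Q a) x * G x a"
    if a: "a \<in> arcs Q" and Gc: "G x a \<in> carrier_mat (n (head Q a)) (n (tail Q a))"
      and e: "\<forall>h\<in>?U. w h x = H h x + (\<Sum>h1\<in>?U. \<Sum>h2\<in>?U. b h h1 h2 * (w h1 x * H h2 x))
      + (\<Sum>h1\<in>?U. \<Sum>h2\<in>?U. c h h1 h2 * (w h1 x * w h2 x))" for x a
  proof (rule eq_matI)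
    let ?h = "head Q a" and ?t = "tail Q a"
    fix i j assume "i < dim_row (S ?h x * G x a)" "j < dim_col (S ?h x * G x a)"
    then have i: "i < n ?h" and j: "j < n ?t" using Sc[of ?h x] Gc by auto
    have U_row: "(a, i, k) \<in> ?U" if "k < n ?t" for k using a i that by (simp add: Upsilon_def)
    have Fx: "F (\<lambda>i. \<phi> i x) a $$ (i, k) = A a $$ (i, k) + \<Phi> (a, i, k) x" if "k < n ?t" for k
    proof -
      have "\<Phi> (a, i, k) x = 0" if "(a, i, k) \<notin> \<Gamma>"
        using D0[OF U_row[OF \<open>k < n ?t\<close>] that] by (simp add: \<Phi>_def)
      then show ?thesis using Fi[OF a i that, of "\<lambda>i. \<phi> i x"] by (auto simp: \<phi>_def inv\<pi>)
    qed
    have syl: "(\<Sum>k<n ?h. X ?h i k x * A a $$ (k, j)) - (\<Sum>k<n ?t. A a $$ (i, k) * X ?t k j x) =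
        w (a, i, j) x + \<Phi> (a, i, j) x"
    proof -
      have "(\<Sum>k<n ?h. X ?h i k x * A a $$ (k, j)) - (\<Sum>k<n ?t. A a $$ (i, k) * X ?t k j x) =
          sylvester Q n n A A (\<lambda>v i j. \<Sum>h\<in>?U. w h x * Z h v i j) (a, i, j)"
        by (simp add: sylvester_def X_def mult.commute)
      also have "\<dots> = (\<Sum>h\<in>?U. w h x * (D h (a, i, j) + (if (a, i, j) = h then 1 else 0)))"
        unfolding sylvester_sum by (simp add: D_def)
      also have "\<dots> = (\<Sum>h\<in>?U. D h (a, i, j) * w h x) + (\<Sum>h\<in>?U. if (a, i, j) = h then w h x else 0)"
        unfolding distrib_left sum.distrib
        by (intro arg_cong2[of _ _ _ _ "(+)"] sum.cong) (auto simp: mult.commute)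
      also have "(\<Sum>h\<in>?U. if (a, i, j) = h then w h x else 0) = w (a, i, j) x"
        using U U_row[OF j] by simp
      finally show ?thesis by (simp add: \<Phi>_def)
    qed
    have s1: "(\<Sum>h1\<in>?U. \<Sum>h2\<in>?U. b (a, i, j) h1 h2 * (w h1 x * H h2 x)) =
        (\<Sum>k<n ?h. X ?h i k x * H (a, k, j) x)"
    proof -
      have "(\<Sum>h2\<in>?U. b (a, i, j) h1 h2 * (w h1 x * H h2 x)) =
          (\<Sum>k<n ?h. Z h1 ?h i k * w h1 x * H (a, k, j) x)" for h1
        by (subst sum_Upsilon_column[OF U a j]) (auto simp: b_def mult.assoc)
      then have "(\<Sum>h1\<in>?U. \<Sum>h2\<in>?U. b (a, i, j) h1 h2 * (w h1 x * H h2 x)) =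
          (\<Sum>h1\<in>?U. \<Sum>k<n ?h. Z h1 ?h i k * w h1 x * H (a, k, j) x)" by simp
      also have "\<dots> = (\<Sum>k<n ?h. \<Sum>h1\<in>?U. Z h1 ?h i k * w h1 x * H (a, k, j) x)" by (rule sum.swap)
      finally show ?thesis by (simp add: X_def sum_distrib_right)
    qed
    have s2: "(\<Sum>h1\<in>?U. \<Sum>h2\<in>?U. c (a, i, j) h1 h2 * (w h1 x * w h2 x)) =
        (\<Sum>k<n ?t. \<Phi> (a, i, k) x * X ?t k j x)"
    proof -
      have "(\<Sum>k<n ?t. \<Phi> (a, i, k) x * X ?t k j x) =
          (\<Sum>k<n ?t. \<Sum>h1\<in>?U. \<Sum>h2\<in>?U. (D h1 (a, i, k) * w h1 x) * (Z h2 ?t k j * w h2 x))"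
        by (simp add: \<Phi>_def X_def sum_product)
      also have "\<dots> = (\<Sum>h1\<in>?U. \<Sum>k<n ?t. \<Sum>h2\<in>?U. (D h1 (a, i, k) * w h1 x) * (Z h2 ?t k j * w h2 x))"
        by (rule sum.swap)
      also have "\<dots> = (\<Sum>h1\<in>?U. \<Sum>h2\<in>?U. \<Sum>k<n ?t. (D h1 (a, i, k) * w h1 x) * (Z h2 ?t k j * w h2 x))"
        by (rule sum.cong[OF refl]) (rule sum.swap)
      also have "\<dots> = (\<Sum>h1\<in>?U. \<Sum>h2\<in>?U. c (a, i, j) h1 h2 * (w h1 x * w h2 x))"
        by (simp add: c_def sum_distrib_right sum_distrib_left mult_ac)
      finally show ?thesis by simp
    qed
    have Gx: "G x a $$ (k, j) = A a $$ (k, j) - H (a, k, j) x" for k by (simp add: H_def)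
    have "(F (\<lambda>i. \<phi> i x) a * S ?t x) $$ (i, j) = (\<Sum>k<n ?t. F (\<lambda>i. \<phi> i x) a $$ (i, k) * S ?t x $$ (k, j))"
      by (rule index_mult_mat_sum[OF Fc[OF a] Sc i j])
    also have "\<dots> = (\<Sum>k<n ?t. (if k = j then A a $$ (i, k) + \<Phi> (a, i, k) x else 0)
        + (A a $$ (i, k) * X ?t k j x + \<Phi> (a, i, k) x * X ?t k j x))"
      using j by (intro sum.cong) (auto simp: Fx S_def algebra_simps)
    also have "\<dots> = A a $$ (i, j) + \<Phi> (a, i, j) x + ((\<Sum>k<n ?t. A a $$ (i, k) * X ?t k j x)
        + (\<Sum>k<n ?t. \<Phi> (a, i, k) x * X ?t k j x))"
      using j by (simp add: sum.distrib)
    also have "\<dots> = A a $$ (i, j) - H (a, i, j) x + ((\<Sum>k<n ?h. X ?h i k x * A a $$ (k, j))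
        - (\<Sum>k<n ?h. X ?h i k x * H (a, k, j) x))"
      using syl e[rule_format, OF U_row[OF j]] unfolding s1 s2 by (simp add: algebra_simps)
    also have "\<dots> = (\<Sum>k<n ?h. (if k = i then G x a $$ (k, j) else 0) + X ?h i k x * G x a $$ (k, j))"
      using i by (simp add: Gx sum.distrib right_diff_distrib sum_subtractf)
    also have "\<dots> = (\<Sum>k<n ?h. S ?h x $$ (i, k) * G x a $$ (k, j))"
      using i by (intro sum.cong) (auto simp: S_def algebra_simps)
    also have "\<dots> = (S ?h x * G x a) $$ (i, j)"
      by (rule index_mult_mat_sum[OF Sc Gc i j, symmetric])
    finally show "(F (\<lambda>i. \<phi> i x) a * S ?t x) $$ (i, j) = (S ?h x * G x a) $$ (i, j)" .
  qed (simp_all add: carrier_matD[OF Fc[OF a]] carrier_matD[OF Sc] carrier_matD[OF Gc])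
  have small: "near_zero ?L (\<lambda>x. \<forall>i\<in>{..<n v}. \<forall>j\<in>{..<n v}. norm (X v i j x) < 1 / (real (n v) + 1))" for v
    by (intro near_zero_ball conv_power_series_small[OF L cX X0]) auto
  have near: "near_zero ?L (\<lambda>x. \<forall>a\<in>arcs Q. G x a \<in> carrier_mat (n (head Q a)) (n (tail Q a)) \<and>
      (\<forall>i\<in>{..<n (tail Q a)}. \<forall>j\<in>{..<n (tail Q a)}. norm (X (tail Q a) i j x) < 1 / (real (n (tail Q a)) + 1)))"
    using G by (intro near_zero_ball near_zero_conj small fin_digraph.finite_arcs[OF Q])
      (auto simp: is_deformation_def conv_power_series_mat_def)
  have "equivalent_deformations Q n ?L G (\<lambda>\<mu>. F (\<lambda>i. \<phi> i \<mu>))"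
    unfolding equivalent_deformations_def
  proof (intro exI[of _ S] conjI ballI)
    fix v
    show "conv_power_series_mat ?L (n v) (n v) (S v)"
      unfolding conv_power_series_mat_def
    proof (intro conjI allI impI)
      show "near_zero ?L (\<lambda>x. S v x \<in> carrier_mat (n v) (n v))" by (rule near_zero_all) (rule Sc)
      show "conv_power_series ?L (\<lambda>x. S v x $$ (i, j))" if "i < n v" "j < n v" for i j
        using conv_power_series_add[OF conv_power_series_const[OF L] cX] that by (simp add: S_def)
    qed
    show "S v (\<lambda>_. 0) = 1\<^sub>m (n v)" by (rule eq_matI) (auto simp: S_def X0)
  next
    show "near_zero ?L (\<lambda>x. \<forall>a\<in>arcs Q. \<exists>T\<in>carrier_mat (n (tail Q a)) (n (tail Q a)).
        inverts_mat (S (tail Q a) x) T \<and> inverts_mat T (S (tail Q a) x) \<and>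
        F (\<lambda>i. \<phi> i x) a = S (head Q a) x * G x a * T)"
    proof (rule near_zero_mono[OF near_zero_conj[OF weq near]], elim conjE, rule ballI)
      fix x a
      let ?h = "head Q a" and ?t = "tail Q a"
      assume e: "\<forall>h\<in>?U. w h x = H h x + (\<Sum>h1\<in>?U. \<Sum>h2\<in>?U. b h h1 h2 * (w h1 x * H h2 x))
          + (\<Sum>h1\<in>?U. \<Sum>h2\<in>?U. c h h1 h2 * (w h1 x * w h2 x))"
        and g: "\<forall>a\<in>arcs Q. G x a \<in> carrier_mat (n (head Q a)) (n (tail Q a)) \<and>
      (\<forall>i\<in>{..<n (tail Q a)}. \<forall>j\<in>{..<n (tail Q a)}. norm (X (tail Q a) i j x) < 1 / (real (n (tail Q a)) + 1))"
        and a: "a \<in> arcs Q"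
      have Gc: "G x a \<in> carrier_mat (n ?h) (n ?t)" using g a by blast
      obtain T where T: "T \<in> carrier_mat (n ?t) (n ?t)" "inverts_mat (S ?t x) T" "inverts_mat T (S ?t x)"
        using near_identity_inverse[of "n ?t" "\<lambda>i j. X ?t i j x"] g a unfolding S_def by auto
      have "F (\<lambda>i. \<phi> i x) a = F (\<lambda>i. \<phi> i x) a * (S ?t x * T)"
        using T(2) Sc[of ?t x] by (simp add: inverts_mat_def right_mult_one_mat[OF Fc[OF a]])
      also have "\<dots> = F (\<lambda>i. \<phi> i x) a * S ?t x * T"
        by (rule assoc_mult_mat[OF Fc[OF a] Sc T(1), symmetric])
      also have "\<dots> = S ?h x * G x a * T" by (simp only: key[OF a Gc e])
      finally show "\<exists>T\<in>carrier_mat (n ?t) (n ?t). inverts_mat (S ?t x) T \<and> inverts_mat T (S ?t x) \<and>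
          F (\<lambda>i. \<phi> i x) a = S ?h x * G x a * T" using T by blast
    qed
  qed
  moreover have "\<forall>i\<in>P. conv_power_series ?L (\<phi> i) \<and> \<phi> i (\<lambda>_. 0) = 0"
    using c\<Phi> \<Phi>0 by (simp add: \<phi>_def)
  ultimately show "\<exists>\<phi>. (\<forall>i\<in>P. conv_power_series ?L (\<phi> i) \<and> \<phi> i (\<lambda>_. 0) = 0) \<and>
      equivalent_deformations Q n ?L G (\<lambda>\<mu>. F (\<lambda>i. \<phi> i \<mu>))"
    by blast
qed

section \<open>Versal families span modulo the tangent space\<close>

lemma near_zero_line:
  assumes "near_zero P R"
  shows "\<forall>\<^sub>F z in nhds (0 :: 'a :: real_normed_field). R (\<lambda>_. z)"
proof -
  obtain r where "r > 0" "\<forall>x. (\<forall>i\<in>P. norm (x i) < r) \<longrightarrow> R x"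
    using assms unfolding near_zero_def by blast
  then show ?thesis unfolding eventually_nhds_metric by (intro exI[of _ r]) (auto simp: dist_norm)
qed

lemma conv_power_series_line_derivative:
  fixes f :: "(nat \<Rightarrow> 'a :: real_or_complex) \<Rightarrow> 'a"
  assumes "conv_power_series {..<1} f"
  shows "\<exists>d. ((\<lambda>z. f (\<lambda>_. z)) has_field_derivative d) (at 0)"
proof -
  obtain d where "gradient_at_0 {..<1} f d" using conv_power_series_gradient[OF _ assms] by auto
  then have "((\<lambda>z. f (\<lambda>_. z)) has_field_derivative (\<Sum>i\<in>{..<1}. d i * 1)) (at 0)"
    unfolding gradient_at_0_def by (elim allE[of _ "\<lambda>_ z. z"] allE[of _ "\<lambda>_. 1"]) auto
  then show ?thesis by blast
qed

text \<open>The family \<open>F\<close> induces the deformation \<open>A + \<mu> C\<close>. Near \<open>0\<close> this means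
  \<open>F (\<phi> \<mu>) S(\<mu>) = S(\<mu>) (A + \<mu> C)\<close>, and the derivative at \<open>\<mu> = 0\<close>, where \<open>S = I\<close>, reads
  \<open>F' + A S' = S' A + C\<close>; here \<open>F'\<close> is a linear combination of the partial derivatives \<open>D\<close> of
  \<open>F\<close> at the origin.\<close>

lemma versal_tangent:
  fixes A :: "('e, 'a :: real_or_complex) rep" and Q :: "('v, 'e) pre_digraph"
  assumes Q: "fin_digraph Q" and A: "is_rep Q n A" and F: "versal Q n A P F"
    and D: "\<And>a i j. (a, i, j) \<in> Upsilon Q n \<Longrightarrow> gradient_at_0 P (\<lambda>x. F x a $$ (i, j)) (\<lambda>p. D p (a, i, j))"
  shows "\<exists>X y. \<forall>h\<in>Upsilon Q n. C h = sylvester Q n n A A X h + (\<Sum>p\<in>P. y p * D p h)"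
proof -
  let ?L = "{..<1 :: nat}"
  have L: "finite ?L" by simp
  have Ac: "A a \<in> carrier_mat (n (head Q a)) (n (tail Q a))" if "a \<in> arcs Q" for a
    using A that by (auto simp: is_rep_def)
  define G where "G \<mu> a = Matrix.mat (n (head Q a)) (n (tail Q a)) (\<lambda>(i, j). A a $$ (i, j) + C (a, i, j) * \<mu> 0)"
    for \<mu> :: "nat \<Rightarrow> 'a" and a
  have Gc: "G x a \<in> carrier_mat (n (head Q a)) (n (tail Q a))" for x a by (simp add: G_def)
  have Gdef: "is_deformation Q n A ?L G"
    unfolding is_deformation_def conv_power_series_mat_def
  proof (intro conjI ballI allI impI)
    fix a assume a: "a \<in> arcs Q"
    show "near_zero ?L (\<lambda>x. G x a \<in> carrier_mat (n (head Q a)) (n (tail Q a)))"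
      by (rule near_zero_all) (rule Gc)
    show "conv_power_series ?L (\<lambda>x. G x a $$ (i, j))" if "i < n (head Q a)" "j < n (tail Q a)" for i j
      using conv_power_series_add[OF conv_power_series_const[OF L]
          conv_power_series_cmult[OF conv_power_series_coord[OF L, of 0]]] that
      by (simp add: G_def)
    show "G (\<lambda>_. 0) a = A a" using Ac[OF a] by (intro eq_matI) (auto simp: G_def)
  qed auto
  obtain \<phi> where \<phi>: "\<forall>p\<in>P. conv_power_series ?L (\<phi> p) \<and> \<phi> p (\<lambda>_. 0) = 0"
    and eq: "equivalent_deformations Q n ?L G (\<lambda>\<mu>. F (\<lambda>i. \<phi> i \<mu>))"
    using F Gdef unfolding versal_def by blast
  obtain S where S: "\<forall>v\<in>verts Q. conv_power_series_mat ?L (n v) (n v) (S v) \<and> S v (\<lambda>_. 0) = 1\<^sub>m (n v)"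
    and near: "near_zero ?L (\<lambda>x. \<forall>a\<in>arcs Q. \<exists>T \<in> carrier_mat (n (tail Q a)) (n (tail Q a)).
            inverts_mat (S (tail Q a) x) T \<and> inverts_mat T (S (tail Q a) x) \<and>
            F (\<lambda>i. \<phi> i x) a = S (head Q a) x * G x a * T)"
    using eq unfolding equivalent_deformations_def by blast
  have F0: "F (\<lambda>_. 0) a = A a" if "a \<in> arcs Q" for a
    using F that unfolding versal_def is_deformation_def by blast
  have hv: "head Q a \<in> verts Q" "tail Q a \<in> verts Q" if "a \<in> arcs Q" for a
    using fin_digraph.axioms(1)[OF Q] that by (auto simp: wf_digraph_def)
  define y where "y p = (SOME d. ((\<lambda>z. \<phi> p (\<lambda>_. z)) has_field_derivative d) (at 0))" for p
  have y: "((\<lambda>z. \<phi> p (\<lambda>_. z)) has_field_derivative y p) (at 0)" if "p \<in> P" for p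
    unfolding y_def using \<phi> that by (intro someI_ex[OF conv_power_series_line_derivative[where f = "\<phi> p"]]) auto
  define Y where "Y v i j = (SOME d. ((\<lambda>z. S v (\<lambda>_. z) $$ (i, j)) has_field_derivative d) (at 0))" for v i j
  have Y: "((\<lambda>z. S v (\<lambda>_. z) $$ (i, j)) has_field_derivative Y v i j) (at 0)"
    if "v \<in> verts Q" "i < n v" "j < n v" for v i j
    unfolding Y_def using S that
    by (intro someI_ex[OF conv_power_series_line_derivative[where f = "\<lambda>x. S v x $$ (i, j)"]]) (auto simp: conv_power_series_mat_def)
  have Sc: "\<forall>\<^sub>F z in nhds 0. S v (\<lambda>_. z) \<in> carrier_mat (n v) (n v)" if "v \<in> verts Q" for v
    using S that by (intro near_zero_line) (auto simp: conv_power_series_mat_def)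
  have "C h = sylvester Q n n A A (\<lambda>v i j. (-1) * Y v i j) h + (\<Sum>p\<in>P. y p * D p h)" if h: "h \<in> Upsilon Q n" for h
  proof -
    obtain a i j where [simp]: "h = (a, i, j)" by (cases h)
    let ?h = "head Q a" and ?t = "tail Q a"
    have a: "a \<in> arcs Q" and i: "i < n ?h" and j: "j < n ?t" using h by (auto simp: Upsilon_def)
    define f where "f k z = F (\<lambda>i. \<phi> i (\<lambda>_. z)) a $$ (i, k)" for k z
    have fd: "(f k has_field_derivative (\<Sum>p\<in>P. D p (a, i, k) * y p)) (at 0)" if "k < n ?t" for k
    proof -
      have "gradient_at_0 P (\<lambda>x. F x a $$ (i, k)) (\<lambda>p. D p (a, i, k))"
        using a i that by (intro D) (auto simp: Upsilon_def)
      then show ?thesis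
        unfolding gradient_at_0_def f_def[abs_def]
        using \<phi> y by (elim allE[of _ "\<lambda>p z. \<phi> p (\<lambda>_. z)"] allE[of _ y]) auto
    qed
    have f0: "f k 0 = A a $$ (i, k)" if "k < n ?t" for k
    proof -
      have 1: "is_deformation Q n A P F" using F by (simp add: versal_def)
      have "conv_power_series P (\<lambda>x. F x a $$ (i, k))"
        using 1 a i that by (auto simp: is_deformation_def conv_power_series_mat_def)
      then have "\<forall>y. (\<forall>p\<in>P. y p = 0) \<longrightarrow> F y a $$ (i, k) = F (\<lambda>_. 0) a $$ (i, k)"
        by (rule near_zeroD0[OF conv_power_series_local])
      then have "F (\<lambda>p. \<phi> p (\<lambda>_. 0)) a $$ (i, k) = F (\<lambda>_. 0) a $$ (i, k)"
        using \<phi> by (elim allE[of _ "\<lambda>p. \<phi> p (\<lambda>_. 0)"]) simp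
      then show ?thesis using F0[OF a] by (simp add: f_def)
    qed
    have ev: "\<forall>\<^sub>F z in nhds 0. (\<Sum>k<n ?t. f k z * S ?t (\<lambda>_. z) $$ (k, j)) =
        (\<Sum>k<n ?h. S ?h (\<lambda>_. z) $$ (i, k) * (A a $$ (k, j) + C (a, k, j) * z))"
      using near_zero_line[OF near] Sc[OF hv(1)[OF a]] Sc[OF hv(2)[OF a]]
    proof eventually_elim
      case (elim z)
      let ?z = "\<lambda>_ :: nat. z"
      obtain T where T: "T \<in> carrier_mat (n ?t) (n ?t)" "inverts_mat T (S ?t ?z)"
          "F (\<lambda>i. \<phi> i ?z) a = S ?h ?z * G ?z a * T"
        using elim(1) a by blast
      have SG: "S ?h ?z * G ?z a \<in> carrier_mat (n ?h) (n ?t)" using elim(2) Gc by (rule mult_carrier_mat)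
      have "F (\<lambda>i. \<phi> i ?z) a * S ?t ?z = S ?h ?z * G ?z a * (T * S ?t ?z)"
        unfolding T(3) by (rule assoc_mult_mat[OF SG T(1) elim(3)])
      also have "\<dots> = S ?h ?z * G ?z a" using T(1,2) by (simp add: inverts_mat_def right_mult_one_mat[OF SG])
      finally have "(F (\<lambda>i. \<phi> i ?z) a * S ?t ?z) $$ (i, j) = (S ?h ?z * G ?z a) $$ (i, j)" by simp
      moreover have "F (\<lambda>i. \<phi> i ?z) a \<in> carrier_mat (n ?h) (n ?t)"
        unfolding T(3) using SG T(1) by (rule mult_carrier_mat)
      ultimately show ?case
        using i j index_mult_mat_sum[OF _ elim(3) i j] index_mult_mat_sum[OF elim(2) Gc i j]
        by (simp add: f_def G_def)
    qed
    have d1: "((\<lambda>z. \<Sum>k<n ?t. f k z * S ?t (\<lambda>_. z) $$ (k, j)) has_field_derivative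
        (\<Sum>k<n ?t. (\<Sum>p\<in>P. D p (a, i, k) * y p) * S ?t (\<lambda>_. 0) $$ (k, j) + Y ?t k j * f k 0)) (at 0)"
      using a j by (intro DERIV_sum DERIV_mult fd Y hv) auto
    have d2: "((\<lambda>z. \<Sum>k<n ?h. S ?h (\<lambda>_. z) $$ (i, k) * (A a $$ (k, j) + C (a, k, j) * z)) has_field_derivative
        (\<Sum>k<n ?h. Y ?h i k * (A a $$ (k, j) + C (a, k, j) * 0) + (0 + C (a, k, j) * 1) * S ?h (\<lambda>_. 0) $$ (i, k))) (at 0)"
      using a i by (intro DERIV_sum DERIV_mult DERIV_add DERIV_const DERIV_cmult DERIV_ident Y hv) auto
    have "(\<Sum>k<n ?t. (\<Sum>p\<in>P. D p (a, i, k) * y p) * S ?t (\<lambda>_. 0) $$ (k, j) + Y ?t k j * f k 0) =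
        (\<Sum>k<n ?h. Y ?h i k * (A a $$ (k, j) + C (a, k, j) * 0) + (0 + C (a, k, j) * 1) * S ?h (\<lambda>_. 0) $$ (i, k))"
      by (rule DERIV_unique[OF _ d2]) (rule iffD1[OF DERIV_cong_ev[OF refl ev refl] d1])
    moreover have "(\<Sum>k<n ?t. (\<Sum>p\<in>P. D p (a, i, k) * y p) * S ?t (\<lambda>_. 0) $$ (k, j) + Y ?t k j * f k 0) =
        (\<Sum>k<n ?t. (if k = j then \<Sum>p\<in>P. y p * D p (a, i, k) else 0) + A a $$ (i, k) * Y ?t k j)"
      using S hv[OF a] j by (intro sum.cong) (auto simp: f0 mult.commute)
    moreover have "(\<Sum>k<n ?h. Y ?h i k * (A a $$ (k, j) + C (a, k, j) * 0) + (0 + C (a, k, j) * 1) * S ?h (\<lambda>_. 0) $$ (i, k)) =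
        (\<Sum>k<n ?h. Y ?h i k * A a $$ (k, j) + (if k = i then C (a, k, j) else 0))"
      using S hv[OF a] i by (intro sum.cong) auto
    ultimately have "(\<Sum>p\<in>P. y p * D p (a, i, j)) + (\<Sum>k<n ?t. A a $$ (i, k) * Y ?t k j) =
        (\<Sum>k<n ?h. Y ?h i k * A a $$ (k, j)) + C (a, i, j)"
      using i j by (simp add: sum.distrib)
    then show ?thesis
      unfolding sylvester_cmult by (simp add: sylvester_def algebra_simps)
  qed
  then show ?thesis by blast
qed

section \<open>Simplest miniversal deformations\<close>

text \<open>A versal family spans modulo the tangent space. If the restriction in the definition of
  \<^const>\<open>transversal\<close> were not injective, some tangent vector would be supported on \<open>\<Gamma>\<close> without
  being zero; a coordinate at which it does not vanish could be dropped from \<open>\<Gamma>\<close>, which leaves a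
  versal family with fewer parameters. Conversely, for a complement, the elementary representations
  of \<open>\<Gamma>\<close> are independent modulo the tangent space, so fewer than \<open>card \<Gamma>\<close> partial
  derivatives of a family cannot span.\<close>

lemma miniversal_iff_transversal:
  fixes A :: "('e, 'a :: real_or_complex) rep" and Q :: "('v, 'e) pre_digraph"
  assumes Q: "fin_digraph Q" and A: "is_rep Q n A" and \<Gamma>: "\<Gamma> \<subseteq> Upsilon Q n" and \<pi>: "bij_betw \<pi> \<Gamma> P"
    and F: "\<And>x a. a \<in> arcs Q \<Longrightarrow> F x a = A a + elem_comb Q n \<Gamma> (\<lambda>g. x (\<pi> g)) a"
  shows "miniversal Q n A P F \<longleftrightarrow> transversal Q n n A A \<Gamma>"
proof
  let ?U = "Upsilon Q n" and ?T = "sylvester Q n n A A"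
  have fin\<Gamma>: "finite \<Gamma>" using \<Gamma> finite_Upsilon[OF Q] by (rule finite_subset)
  have P: "finite P" using fin\<Gamma> \<pi> bij_betw_finite by blast
  have card: "card P = card \<Gamma>" using \<pi> by (simp add: bij_betw_same_card)
  {
    assume M: "miniversal Q n A P F"
    define D where "D p h = (if h \<in> \<Gamma> \<and> p = \<pi> h then 1 else 0 :: 'a)" for p h
    have grad: "gradient_at_0 P (\<lambda>x. F x a $$ (i, j)) (\<lambda>p. D p (a, i, j))" if h: "(a, i, j) \<in> ?U" for a i j
      unfolding gradient_at_0_def
    proof (intro allI impI)
      fix \<gamma> \<gamma>' assume g: "\<forall>p\<in>P. \<gamma> p 0 = 0 \<and> (\<gamma> p has_field_derivative \<gamma>' p) (at (0 :: 'a))"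
      have ij: "a \<in> arcs Q" "i < n (head Q a)" "j < n (tail Q a)" using h by (auto simp: Upsilon_def)
      have Fi: "F x a $$ (i, j) = A a $$ (i, j) + (if (a, i, j) \<in> \<Gamma> then x (\<pi> (a, i, j)) else 0)" for x
        unfolding F[OF ij(1)] using ij elem_comb_carrier[of Q n \<Gamma> "\<lambda>g. x (\<pi> g)" a]
        by (simp add: elem_comb_index[OF fin\<Gamma>])
      show "((\<lambda>z. F (\<lambda>p. \<gamma> p z) a $$ (i, j)) has_field_derivative (\<Sum>p\<in>P. D p (a, i, j) * \<gamma>' p)) (at 0)"
      proof (cases "(a, i, j) \<in> \<Gamma>")
        case True
        then have "\<pi> (a, i, j) \<in> P" using \<pi> by (auto simp: bij_betw_def)
        moreover have "(\<Sum>p\<in>P. D p (a, i, j) * \<gamma>' p) = (\<Sum>p\<in>P. if p = \<pi> (a, i, j) then \<gamma>' p else 0)"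
          using True by (intro sum.cong) (auto simp: D_def)
        ultimately have s: "(\<Sum>p\<in>P. D p (a, i, j) * \<gamma>' p) = \<gamma>' (\<pi> (a, i, j))" using P by simp
        have "((\<lambda>z. A a $$ (i, j) + \<gamma> (\<pi> (a, i, j)) z) has_field_derivative 0 + \<gamma>' (\<pi> (a, i, j))) (at 0)"
          using g \<open>\<pi> (a, i, j) \<in> P\<close> by (intro DERIV_add DERIV_const) auto
        then show ?thesis using True s by (simp add: Fi)
      next
        case False
        then show ?thesis by (simp add: Fi D_def)
      qed
    qed
    have vers: "versal Q n A P F" using M by (simp add: miniversal_def)
    have span: "\<exists>X. \<forall>h\<in>?U - \<Gamma>. ?T X h = C h" for C
    proof -
      obtain X y where "\<forall>h\<in>?U. C h = ?T X h + (\<Sum>p\<in>P. y p * D p h)"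
        using versal_tangent[where D = D, OF Q A vers grad] by blast
      then have "\<forall>h\<in>?U - \<Gamma>. ?T X h = C h" by (simp add: D_def)
      then show ?thesis by blast
    qed
    have inj: "?T X0 g = 0" if X0: "\<forall>h\<in>?U - \<Gamma>. ?T X0 h = 0" and g: "g \<in> ?U" for X0 g
    proof (rule ccontr)
      assume ng: "?T X0 g \<noteq> 0"
      then have g\<Gamma>: "g \<in> \<Gamma>" using X0 g by auto
      define \<Gamma>' where "\<Gamma>' = \<Gamma> - {g}"
      have \<Gamma>': "\<Gamma>' \<subseteq> ?U" "finite \<Gamma>'" "card \<Gamma>' < card P"
        using \<Gamma> fin\<Gamma> g\<Gamma> card card_Diff1_less[OF fin\<Gamma> g\<Gamma>] by (auto simp: \<Gamma>'_def)
      obtain \<pi>' where \<pi>': "bij_betw \<pi>' \<Gamma>' {..<card \<Gamma>'}"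
        using ex_bij_betw_finite_nat[OF \<Gamma>'(2)] by (auto simp: atLeast0LessThan)
      have span': "\<exists>X. \<forall>h\<in>?U - \<Gamma>'. ?T X h = C h" for C
      proof -
        obtain X where X: "\<forall>h\<in>?U - \<Gamma>. ?T X h = C h" using span by blast
        (* Adding a multiple of X0 corrects the entry g and nothing outside the set of coordinates. *)
        define c where "c = (C g - ?T X g) / ?T X0 g"
        have "?T (\<lambda>v i j. X v i j + c * X0 v i j) h = C h" if "h \<in> ?U - \<Gamma>'" for h
          unfolding sylvester_add sylvester_cmult
          using that X X0 ng by (cases "h = g") (auto simp: c_def \<Gamma>'_def)
        then show ?thesis by blast
      qed
      have "versal Q n A {..<card \<Gamma>'} (\<lambda>x a. A a + elem_comb Q n \<Gamma>' (\<lambda>g. x (\<pi>' g)) a)"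
        by (rule versal_of_spanning[OF Q A \<Gamma>'(1) \<pi>' span']) simp
      then show False using M \<Gamma>'(3) by (auto simp: miniversal_def)
    qed
    show "transversal Q n n A A \<Gamma>"
      unfolding transversal_def arrow_entries_Upsilon using span inj by blast
  next
    assume T: "transversal Q n n A A \<Gamma>"
    then have span: "\<exists>X. \<forall>h\<in>?U - \<Gamma>. ?T X h = C h" for C
      unfolding transversal_def arrow_entries_Upsilon by blast
    have inj: "?T X h = 0" if "\<forall>h\<in>?U - \<Gamma>. ?T X h = 0" "h \<in> ?U" for X h
      using T that unfolding transversal_def arrow_entries_Upsilon by blast
    have "versal Q n A P F" by (rule versal_of_spanning[OF Q A \<Gamma> \<pi> span F])
    moreover have "\<not> versal Q n A {..<k} F'" if k: "k < card P" for k and F' :: "(nat \<Rightarrow> 'a) \<Rightarrow> ('e, 'a) rep"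
    proof
      assume v: "versal Q n A {..<k} F'"
      define D where "D p h = (SOME d. gradient_at_0 {..<k} (\<lambda>x. F' x (fst h) $$ snd h) d) p" for p :: nat and h
      have D: "gradient_at_0 {..<k} (\<lambda>x. F' x a $$ (i, j)) (\<lambda>p. D p (a, i, j))" if "(a, i, j) \<in> ?U" for a i j
      proof -
        have "conv_power_series {..<k} (\<lambda>x. F' x a $$ (i, j))"
          using v that by (auto simp: versal_def is_deformation_def conv_power_series_mat_def Upsilon_def)
        then show ?thesis unfolding D_def fst_conv snd_conv
          by (rule someI_ex[OF conv_power_series_gradient[OF finite_lessThan]])
      qed
      define R where "R g Xy \<longleftrightarrow> (\<forall>h\<in>?U. (if h = g then 1 else 0) = ?T (fst Xy) h + (\<Sum>p<k. snd Xy p * D p h))"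
        for g and Xy :: "('v \<Rightarrow> nat \<Rightarrow> nat \<Rightarrow> 'a) \<times> (nat \<Rightarrow> 'a)"
      define Xy where "Xy g = (SOME Xy. R g Xy)" for g
      have "\<exists>Xy. R g Xy" for g
        using versal_tangent[where D = D and C = "\<lambda>h. if h = g then 1 else 0", OF Q A v D]
        by (auto simp: R_def)
      then have "R g (Xy g)" for g unfolding Xy_def by (rule someI_ex)
      then have R: "?T (fst (Xy g)) h = (if h = g then 1 else 0) - (\<Sum>p<k. snd (Xy g) p * D p h)"
        if "h \<in> ?U" for g h
        using that by (simp add: R_def)
      (* A combination of the elementary representations of the coordinate set in which the
         derivatives of the smaller family cancel: it is a tangent vector. *)
      obtain c where c: "\<exists>g\<in>\<Gamma>. c g \<noteq> 0" "\<forall>p<k. (\<Sum>g\<in>\<Gamma>. c g * snd (Xy g) p) = 0"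
        using underdetermined_system[OF fin\<Gamma>, of k "\<lambda>g. snd (Xy g)"] k card by auto
      define X where "X v i j = (\<Sum>g\<in>\<Gamma>. c g * fst (Xy g) v i j)" for v i j
      have X: "?T X h = (if h \<in> \<Gamma> then c h else 0)" if h: "h \<in> ?U" for h
      proof -
        have "?T X h = (\<Sum>g\<in>\<Gamma>. c g * ?T (fst (Xy g)) h)"
          unfolding X_def[abs_def] by (rule sylvester_sum)
        also have "\<dots> = (\<Sum>g\<in>\<Gamma>. (if h = g then c g else 0) - (\<Sum>p<k. c g * snd (Xy g) p * D p h))"
          by (intro sum.cong) (auto simp: R[OF h] right_diff_distrib sum_distrib_left mult.assoc)
        also have "\<dots> = (\<Sum>g\<in>\<Gamma>. if h = g then c g else 0) - (\<Sum>g\<in>\<Gamma>. \<Sum>p<k. c g * snd (Xy g) p * D p h)"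
          by (rule sum_subtractf)
        also have "(\<Sum>g\<in>\<Gamma>. \<Sum>p<k. c g * snd (Xy g) p * D p h) = (\<Sum>p<k. (\<Sum>g\<in>\<Gamma>. c g * snd (Xy g) p) * D p h)"
          unfolding sum_distrib_right by (rule sum.swap)
        also have "\<dots> = 0" using c(2) by simp
        finally show ?thesis using fin\<Gamma> by simp
      qed
      have "c g = 0" if "g \<in> \<Gamma>" for g
        using inj[of X g] X \<Gamma> that by auto
      then show False using c(1) by blast
    qed
    ultimately show "miniversal Q n A P F" by (auto simp: miniversal_def)
  }
qed

lemma simplest_miniversal_iff_transversal:
  fixes A :: "('e, 'a :: real_or_complex) rep" and Q :: "('v, 'e) pre_digraph"
  assumes "fin_digraph Q" "is_rep Q n A" "\<Gamma> \<subseteq> Upsilon Q n" "bij_betw \<pi> \<Gamma> P"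
    and "\<And>x a. a \<in> arcs Q \<Longrightarrow> F x a = A a + elem_comb Q n \<Gamma> (\<lambda>g. x (\<pi> g)) a"
  shows "simplest_miniversal Q n A P F \<longleftrightarrow> transversal Q n n A A \<Gamma>"
proof -
  have "near_zero P (\<lambda>\<epsilon>. \<forall>a\<in>arcs Q. F \<epsilon> a = A a + elem_comb Q n \<Gamma> (\<lambda>g. \<epsilon> (\<pi> g)) a)"
    by (rule near_zero_all) (simp add: assms(5))
  then have "simplest_miniversal Q n A P F \<longleftrightarrow> miniversal Q n A P F"
    unfolding simplest_miniversal_def using assms(3,4) by blast
  then show ?thesis using miniversal_iff_transversal[OF assms] by simp
qed

text \<open>Places the rows (or columns) of \<open>A\<^sub>p \<oplus> A\<^sub>q\<close> at their positions in the large direct sum.\<close>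

definition embed_pair :: "(nat \<Rightarrow> 'v \<Rightarrow> nat) \<Rightarrow> nat \<Rightarrow> nat \<Rightarrow> 'v \<Rightarrow> nat \<Rightarrow> nat" where
  "embed_pair n p q v i = (if i < n p v then offset n p v + i else offset n q v + (i - n p v))"

lemma inj_on_embed_pair:
  assumes "p < q"
  shows "inj_on (embed_pair n p q v) {..<n p v + n q v}"
proof -
  have "offset n p v + n p v \<le> offset n q v" using offset_mono[of "Suc p" q n v] assms by simp
  then show ?thesis by (auto simp: inj_on_def embed_pair_def split: if_splits)
qed

lemma image_embed_pair:
  "embed_pair n p q v ` {..<n p v + n q v} = strip n p v \<union> strip n q v"
proof (intro equalityI subsetI)
  fix x assume "x \<in> strip n p v \<union> strip n q v"
  then consider "x \<in> strip n p v" | "x \<in> strip n q v" by blast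
  then show "x \<in> embed_pair n p q v ` {..<n p v + n q v}"
  proof cases
    case 1
    then show ?thesis by (intro image_eqI[of _ _ "x - offset n p v"]) (auto simp: strip_def embed_pair_def)
  next
    case 2
    then show ?thesis by (intro image_eqI[of _ _ "x - offset n q v + n p v"]) (auto simp: strip_def embed_pair_def)
  qed
qed (auto simp: strip_def embed_pair_def split: if_splits)

text \<open>The family \<^const>\<open>pair_family\<close> is again a family of elementary representations, with
  coordinates pulled back along \<^const>\<open>embed_pair\<close>; it is therefore governed by the four blocks of
  \<open>\<Gamma>\<close> in the strips \<open>p\<close> and \<open>q\<close>.\<close>

lemma simplest_miniversal_pair:
  fixes Q :: "('v, 'e) pre_digraph" and A :: "nat \<Rightarrow> ('e, 'a :: real_or_complex) rep"
  assumes Q: "fin_digraph Q" and pq: "p < q" "q < s" and A: "\<And>p. p < s \<Longrightarrow> is_rep Q (n p) (A p)"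
    and \<Gamma>: "\<Gamma> \<subseteq> Upsilon Q (offset n s)"
  defines "T \<equiv> \<lambda>r t. transversal Q (n r) (n t) (A r) (A t) (block_entries Q n r t \<Gamma>)"
  shows "simplest_miniversal Q (\<lambda>v. n p v + n q v) (rep_sum [A p, A q])
      (pair_params Q n \<Gamma> p q) (pair_family Q n A (elem_comb Q (offset n s) \<Gamma>) p q)
    \<longleftrightarrow> T p p \<and> T p q \<and> T q p \<and> T q q"
proof -
  let ?N = "\<lambda>v. n p v + n q v"
  let ?e = "embed_pair n p q"
  define idx where "idx r = (if r = 0 then p else q)" for r :: nat
  define n' where "n' r = n (idx r)" for r
  define A' where "A' r = A (idx r)" for r
  have idx: "idx r < s" for r using pq by (simp add: idx_def)
  have N': "offset n' 2 = ?N" by (rule ext) (simp add: numeral_2_eq_2 n'_def idx_def)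
  have S': "rep_sum (map A' [0..<2]) = rep_sum [A p, A q]"
    by (simp add: numeral_2_eq_2 A'_def idx_def)
  have A': "is_rep Q (n' r) (A' r)" for r unfolding n'_def A'_def by (rule A[OF idx])
  have e: "?e v (offset n' r v + i) = offset n (idx r) v + i" if "r < 2" "i < n' r v" for r v i
    using that by (auto simp: embed_pair_def n'_def idx_def less_2_cases_iff)
  have e_less: "?e v i < offset n s v" if "i < ?N v" for v i
    using that pq offset_add_less[of p s i n v] offset_add_less[of q s "i - n p v" n v]
    by (auto simp: embed_pair_def)
  define \<pi> where "\<pi> = (\<lambda>(a, i, j). (a, ?e (head Q a) i, ?e (tail Q a) j))"
  define \<Gamma>' where "\<Gamma>' = {g \<in> Upsilon Q ?N. \<pi> g \<in> \<Gamma>}"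
  have fin: "finite \<Gamma>" "finite \<Gamma>'"
    using finite_Upsilon[OF Q] \<Gamma> by (auto simp: \<Gamma>'_def intro: finite_subset)
  have bij: "bij_betw \<pi> \<Gamma>' (pair_params Q n \<Gamma> p q)"
  proof (rule bij_betw_imageI)
    have "inj_on \<pi> (Upsilon Q ?N)"
      using inj_on_embed_pair[OF pq(1), of n] by (auto simp: inj_on_def \<pi>_def Upsilon_def)
    then show "inj_on \<pi> \<Gamma>'" by (rule inj_on_subset) (auto simp: \<Gamma>'_def)
    have str: "?e v i \<in> strip n p v \<union> strip n q v" if "i < ?N v" for v i
      using image_embed_pair[of n p q v] that by blast
    show "\<pi> ` \<Gamma>' = pair_params Q n \<Gamma> p q"
    proof (intro equalityI subsetI)
      fix g assume "g \<in> \<pi> ` \<Gamma>'"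
      then show "g \<in> pair_params Q n \<Gamma> p q"
        using str by (force simp: \<Gamma>'_def \<pi>_def pair_params_def Upsilon_def)
    next
      fix g assume g: "g \<in> pair_params Q n \<Gamma> p q"
      obtain a I J where [simp]: "g = (a, I, J)" by (cases g)
      have "a \<in> arcs Q" using g \<Gamma> by (auto simp: pair_params_def Upsilon_def)
      moreover obtain i where "i < ?N (head Q a)" "I = ?e (head Q a) i"
        using g image_embed_pair[of n p q "head Q a"] by (auto simp: pair_params_def)
      moreover obtain j where "j < ?N (tail Q a)" "J = ?e (tail Q a) j"
        using g image_embed_pair[of n p q "tail Q a"] by (auto simp: pair_params_def)
      ultimately show "g \<in> \<pi> ` \<Gamma>'"
        using g by (intro image_eqI[of _ _ "(a, i, j)"]) (auto simp: \<Gamma>'_def \<pi>_def pair_params_def Upsilon_def)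
    qed
  qed
  have fam: "pair_family Q n A (elem_comb Q (offset n s) \<Gamma>) p q x a =
      rep_sum [A p, A q] a + elem_comb Q ?N \<Gamma>' (\<lambda>g. x (\<pi> g)) a" if a: "a \<in> arcs Q" for x a
  proof (rule eq_matI)
    let ?h = "head Q a" and ?t = "tail Q a"
    have c: "A p a \<in> carrier_mat (n p ?h) (n p ?t)" "A q a \<in> carrier_mat (n q ?h) (n q ?t)"
      using A[of p] A[of q] pq a by (auto simp: is_rep_def)
    have ec: "elem_comb Q ?N \<Gamma>' (\<lambda>g. x (\<pi> g)) a \<in> carrier_mat (?N ?h) (?N ?t)"
      by (rule elem_comb_carrier[where n = ?N])
    have rs: "rep_sum [A p, A q] a = four_block_mat (A p a) (0\<^sub>m (n p ?h) (n q ?t)) (0\<^sub>m (n q ?h) (n p ?t)) (A q a)"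
      unfolding rep_sum_def list.map diag_block_mat.simps(2)[of "A p a"] Let_def diag_block_mat_singleton
      using c by simp
    {
      fix i j assume "i < dim_row (rep_sum [A p, A q] a + elem_comb Q ?N \<Gamma>' (\<lambda>g. x (\<pi> g)) a)"
        "j < dim_col (rep_sum [A p, A q] a + elem_comb Q ?N \<Gamma>' (\<lambda>g. x (\<pi> g)) a)"
      then have ij: "i < ?N ?h" "j < ?N ?t" using ec by auto
      have mem: "(a, i, j) \<in> \<Gamma>' \<longleftrightarrow> (a, ?e ?h i, ?e ?t j) \<in> \<Gamma>"
        using a ij by (simp add: \<Gamma>'_def \<pi>_def Upsilon_def)
      have E: "elem_comb Q ?N \<Gamma>' (\<lambda>g. x (\<pi> g)) a $$ (i, j) =
          (if (a, ?e ?h i, ?e ?t j) \<in> \<Gamma> then x (a, ?e ?h i, ?e ?t j) else 0)"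
        unfolding elem_comb_index[where n = ?N, OF fin(2) ij] mem by (simp add: \<pi>_def)
      have E': "elem_comb Q (offset n s) \<Gamma> x a $$ (?e ?h i, ?e ?t j) =
          (if (a, ?e ?h i, ?e ?t j) \<in> \<Gamma> then x (a, ?e ?h i, ?e ?t j) else 0)"
        by (rule elem_comb_index[OF fin(1) e_less[OF ij(1)] e_less[OF ij(2)]])
      show "pair_family Q n A (elem_comb Q (offset n s) \<Gamma>) p q x a $$ (i, j) =
          (rep_sum [A p, A q] a + elem_comb Q ?N \<Gamma>' (\<lambda>g. x (\<pi> g)) a) $$ (i, j)"
        using c ec ij E' unfolding rs pair_family_def
        by (cases "i < n p ?h"; cases "j < n p ?t") (auto simp: E rep_block_def embed_pair_def)
    }
    show "dim_row (pair_family Q n A (elem_comb Q (offset n s) \<Gamma>) p q x a) =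
        dim_row (rep_sum [A p, A q] a + elem_comb Q ?N \<Gamma>' (\<lambda>g. x (\<pi> g)) a)"
      "dim_col (pair_family Q n A (elem_comb Q (offset n s) \<Gamma>) p q x a) =
        dim_col (rep_sum [A p, A q] a + elem_comb Q ?N \<Gamma>' (\<lambda>g. x (\<pi> g)) a)"
      using ec by (simp_all add: pair_family_def rep_block_def)
  qed
  have blocks: "block_entries Q n' r t \<Gamma>' = block_entries Q n (idx r) (idx t) \<Gamma>" if rt: "r < 2" "t < 2" for r t
  proof -
    have "(a, offset n' r (head Q a) + i, offset n' t (tail Q a) + j) \<in> \<Gamma>' \<longleftrightarrow>
        (a, offset n (idx r) (head Q a) + i, offset n (idx t) (tail Q a) + j) \<in> \<Gamma>"
      if "(a, i, j) \<in> arrow_entries Q (n' r) (n' t)" for a i j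
      using that rt offset_add_less[of r 2 i n' "head Q a"] offset_add_less[of t 2 j n' "tail Q a"]
      unfolding N' by (simp add: \<Gamma>'_def \<pi>_def e arrow_entries_def Upsilon_def)
    then show ?thesis unfolding block_entries_def by (auto simp: n'_def[symmetric])
  qed
  have rep: "is_rep Q ?N (rep_sum [A p, A q])"
    using rep_sum_carrier[where n = n' and A = A' and s = 2, OF A'] unfolding is_rep_def S' N' by blast
  have "simplest_miniversal Q ?N (rep_sum [A p, A q])
      (pair_params Q n \<Gamma> p q) (pair_family Q n A (elem_comb Q (offset n s) \<Gamma>) p q)
    \<longleftrightarrow> transversal Q ?N ?N (rep_sum [A p, A q]) (rep_sum [A p, A q]) \<Gamma>'"
    by (rule simplest_miniversal_iff_transversal[OF Q rep _ bij fam]) (simp_all add: \<Gamma>'_def)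
  also have "\<dots> \<longleftrightarrow> (\<forall>r<2. \<forall>t<2. transversal Q (n' r) (n' t) (A' r) (A' t) (block_entries Q n' r t \<Gamma>'))"
    using transversal_rep_sum[where n = n' and A = A' and s = 2 and \<Gamma> = \<Gamma>', OF A'] unfolding S' N' .
  also have "\<dots> \<longleftrightarrow> (\<forall>r<2. \<forall>t<2. T (idx r) (idx t))"
    using blocks by (simp add: T_def n'_def A'_def)
  also have "\<dots> \<longleftrightarrow> T p p \<and> T p q \<and> T q p \<and> T q q"
    by (auto simp: idx_def less_2_cases_iff)
  finally show ?thesis .
qed

theorem theorem4:
  fixes Q :: "('v, 'e) pre_digraph"
    and s :: nat
    and n :: "nat \<Rightarrow> 'v \<Rightarrow> nat"
    and A :: "nat \<Rightarrow> ('e, 'a :: real_or_complex) rep"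
    and \<Gamma> :: "('e \<times> nat \<times> nat) set"
    and N :: "'v \<Rightarrow> nat"
    and A\<^sub>0 :: "('e, 'a) rep"
    and B :: "('e \<times> nat \<times> nat \<Rightarrow> 'a) \<Rightarrow> ('e, 'a) rep"
  assumes "fin_digraph Q"
    and "s \<ge> 2"
    and "\<And>p. p < s \<Longrightarrow> is_rep Q (n p) (A p)"
    and "N = (\<lambda>v. \<Sum>p<s. n p v)"
    and "A\<^sub>0 = rep_sum (map A [0..<s])"
    and "\<Gamma> \<subseteq> Upsilon Q N"
    and "B = elem_comb Q N \<Gamma>"
  shows "simplest_miniversal Q N A\<^sub>0 \<Gamma> (\<lambda>\<epsilon> a. A\<^sub>0 a + B \<epsilon> a) \<longleftrightarrow>
    (\<forall>p q. p < q \<and> q < s \<longrightarrow>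
       simplest_miniversal Q (\<lambda>v. n p v + n q v) (rep_sum [A p, A q])
         (pair_params Q n \<Gamma> p q) (pair_family Q n A B p q))"
proof -
  define T where "T r t = transversal Q (n r) (n t) (A r) (A t) (block_entries Q n r t \<Gamma>)" for r t
  have N: "N = offset n s" by (rule ext) (simp add: assms(4) offset_def)
  have A\<^sub>0: "is_rep Q N A\<^sub>0"
    using rep_sum_carrier[where n = n and A = A, OF assms(3)] unfolding is_rep_def N assms(5) by blast
  have "simplest_miniversal Q N A\<^sub>0 \<Gamma> (\<lambda>\<epsilon> a. A\<^sub>0 a + B \<epsilon> a) \<longleftrightarrow> transversal Q N N A\<^sub>0 A\<^sub>0 \<Gamma>"
    by (rule simplest_miniversal_iff_transversal[where \<pi> = "\<lambda>g. g", OF assms(1) A\<^sub>0 assms(6)])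
      (simp_all add: assms(7) bij_betw_def)
  also have "\<dots> \<longleftrightarrow> (\<forall>p<s. \<forall>q<s. T p q)"
    unfolding N assms(5) T_def by (rule transversal_rep_sum[OF assms(3)])
  also have "\<dots> \<longleftrightarrow> (\<forall>p q. p < q \<and> q < s \<longrightarrow> T p p \<and> T p q \<and> T q p \<and> T q q)"
  proof (intro iffI allI impI)
    fix p q assume R: "\<forall>p q. p < q \<and> q < s \<longrightarrow> T p p \<and> T p q \<and> T q p \<and> T q q" and pq: "p < s" "q < s"
    consider "p < q" | "q < p" | "p = q" "p < s - 1" | "p = q" "0 < p" using pq assms(2) by linarith
    then show "T p q"
    proof cases
      case 3
      then show ?thesis using R[rule_format, of p "s - 1"] pq by simp
    next
      case 4
      then show ?thesis using R[rule_format, of 0 p] pq by simp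
    qed (use R pq in auto)
  qed (meson less_trans)
  also have "\<dots> \<longleftrightarrow> (\<forall>p q. p < q \<and> q < s \<longrightarrow>
       simplest_miniversal Q (\<lambda>v. n p v + n q v) (rep_sum [A p, A q])
         (pair_params Q n \<Gamma> p q) (pair_family Q n A B p q))"
    unfolding T_def assms(7) N
    using simplest_miniversal_pair[where n = n and A = A and s = s and \<Gamma> = \<Gamma>, OF assms(1) _ _ assms(3) assms(6)[unfolded N]]
    by simp
  finally show ?thesis .
qed

end
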